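(* The map $\mathbb B\to\mathbb V(\overline K)$, sending $B^\bullet\in\mathbb B_{\mathrm{qcut}}$ to (the class of) $\omega_{B^\bullet}$ and $[\mathcal B]\in\mathbb B_\infty$ to $\omega_{\mathcal B}$, is an isomorphism of posets.
   Context: $(K,v)$ valued field, $\overline K$ algebraic closure, $\bar v$ fixed extension of $v$ to $\overline K$, value group $\Gamma$. Quasi-cuts $\delta=(\delta^L,\delta^R)$: $\delta^L\le\delta^R$, $\delta^L\cup\delta^R=\Gamma$; $\operatorname{Qcuts}(\Gamma)=\Gamma\sqcup\operatorname{Cuts}(\Gamma)$ ($\gamma\leftrightarrow(\Gamma_{\le\gamma},\Gamma_{\ge\gamma})$; cuts have $\delta^L<\delta^R$), totally ordered by $\delta\le\epsilon\iff\delta^L\subseteq\epsilon^L,\ \delta^R\supseteq\epsilon^R$. Balls $B(a,\gamma)=\{c:\bar v(c-a)\ge\gamma\}$ ($\gamma\in\Gamma$), $B(a,\delta)=\{c:\bar v(c-a)>\delta^L\}$ ($\delta$ a cut). Pointed balls $B^\bullet(a,\delta)=(B(a,\delta),\delta)$ form $\mathbb B_{\mathrm{qcut}}$, ordered by $B^\bullet(a,\delta)\le B^\bullet(b,\epsilon)\iff B(a,\delta)\supseteq B(b,\epsilon)$ and $\delta\le\epsilon$. $x_\delta=\delta$ if $\delta\in\Gamma$; for a cut, $x_\delta$ is a formal element of $\Gamma(\delta)=x_\delta\mathbb Z\oplus\Gamma$ ordered with $\delta^L<x_\delta<\delta^R$; $\omega_{B^\bullet(a,\delta)}=\omega_{a,\delta}$,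 $\omega_{a,\delta}(\sum a_n(x-a)^n)=\min_n\{\bar v(a_n)+nx_\delta\}$. $\mathbb B_\infty$ is the set of classes, under mutual cofinality, of nests $\mathcal B=(B_i)_{i\in I}$ of closed balls with radii in $\Gamma$ (strictly decreasing in $i$) with $\bigcap B_i=\emptyset$, and $\omega_{\mathcal B}(f)=\max_i\omega_{B_i}(f)$. $\mathbb B=\mathbb B_\infty\sqcup\mathbb B_{\mathrm{qcut}}$ is ordered by the order of $\mathbb B_{\mathrm{qcut}}$, elements of $\mathbb B_\infty$ being pairwise incomparable, and $B^\bullet\le[\mathcal B]\iff\operatorname{under}(B^\bullet)\supseteq B_i$ for some $i$, where $\operatorname{under}(B(a,\delta),\delta)=B(a,\delta)$. $\mathbb V(\overline K)$ is the set of equivalence classes of valuations on $\overline K(x)$ extending $\bar v$ (up to equivalence), with partial order: $\mu\le\nu$ iff $\mu(f)\le\nu(f)$ for all $f\in\overline K[x]$, understood for inequivalent $\mu,\nu$ as: for each $f$ there is $\gamma\in\Gamma$ with $\mu(f)\le\gamma\le\nu(f)$. *)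

theory Defs
  imports "HOL-Computational_Algebra.Polynomial" "HOL-Computational_Algebra.Fraction_Field"
begin

(* v is only meaningful on nonzero elements; v(0) = infinity is handled explicitly *)
definition is_valuation :: "('a::field \<Rightarrow> 'g::linordered_ab_group_add) \<Rightarrow> bool" where
  "is_valuation v \<longleftrightarrow>
     (\<forall>x y. x \<noteq> 0 \<longrightarrow> y \<noteq> 0 \<longrightarrow> v (x * y) = v x + v y) \<and>
     (\<forall>x y. x \<noteq> 0 \<longrightarrow> y \<noteq> 0 \<longrightarrow> x + y \<noteq> 0 \<longrightarrow> min (v x) (v y) \<le> v (x + y))"

definition alg_closed :: "'a::field itself \<Rightarrow> bool" where
  "alg_closed _ \<longleftrightarrow> (\<forall>p :: 'a poly. 0 < degree p \<longrightarrow> (\<exists>x. poly p x = 0))"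

definition gsmul :: "nat \<Rightarrow> 'g::ab_group_add \<Rightarrow> 'g" where
  "gsmul n g = (\<Sum>_\<in>{..<n}. g)"

type_synonym 'g qcut = "'g set \<times> 'g set"

definition is_qcut :: "'g::linorder qcut \<Rightarrow> bool" where
  "is_qcut \<delta> \<longleftrightarrow> (\<forall>l\<in>fst \<delta>. \<forall>r\<in>snd \<delta>. l \<le> r) \<and> fst \<delta> \<union> snd \<delta> = UNIV"

definition is_cut :: "'g::linorder qcut \<Rightarrow> bool" where
  "is_cut \<delta> \<longleftrightarrow> is_qcut \<delta> \<and> fst \<delta> \<inter> snd \<delta> = {}"

definition qc_of :: "'g::linorder \<Rightarrow> 'g qcut" where
  "qc_of \<gamma> = ({..\<gamma>}, {\<gamma>..})"

(* for a quasi-cut that is not a cut: the element of Gamma it represents *)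
definition qc_rad :: "'g::linorder qcut \<Rightarrow> 'g" where
  "qc_rad \<delta> = (THE \<gamma>. \<gamma> \<in> fst \<delta> \<inter> snd \<delta>)"

definition qc_le :: "'g::linorder qcut \<Rightarrow> 'g qcut \<Rightarrow> bool" where
  "qc_le \<delta> \<epsilon> \<longleftrightarrow> fst \<delta> \<subseteq> fst \<epsilon> \<and> snd \<epsilon> \<subseteq> snd \<delta>"

definition cball_v :: "('a::field \<Rightarrow> 'g::linordered_ab_group_add) \<Rightarrow> 'a \<Rightarrow> 'g \<Rightarrow> 'a set" where
  "cball_v v a \<gamma> = {c. c = a \<or> \<gamma> \<le> v (c - a)}"

definition ball_v :: "('a::field \<Rightarrow> 'g::linordered_ab_group_add) \<Rightarrow> 'a \<Rightarrow> 'g qcut \<Rightarrow> 'a set" where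
  "ball_v v a \<delta> =
     (if is_cut \<delta> then {c. c = a \<or> (\<forall>l\<in>fst \<delta>. l < v (c - a))}
      else cball_v v a (qc_rad \<delta>))"

(* coefficients of f in the expansion f = sum a_n (x - a)^n *)
definition shift :: "'a::field \<Rightarrow> 'a poly \<Rightarrow> 'a poly" where
  "shift a f = pcompose f [:a, 1:]"

(* order on Gamma(delta) = x_delta Z + Gamma; (n, eta) stands for n*x_delta + eta
   (for delta in Gamma, x_delta = delta). Uses that Gamma is divisible
   (automatic for the algebraically closed field Kbar). *)
definition gd_le :: "'g::linordered_ab_group_add qcut \<Rightarrow> nat \<times> 'g \<Rightarrow> nat \<times> 'g \<Rightarrow> bool" where
  "gd_le \<delta> p q =
     (let (n, \<eta>) = p; (m, \<eta>') = q in
      if is_cut \<delta> then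
        (if n = m then \<eta> \<le> \<eta>'
         else if m < n then (\<exists>r\<in>snd \<delta>. gsmul (n - m) r \<le> \<eta>' - \<eta>)
         else (\<exists>l\<in>fst \<delta>. \<eta> - \<eta>' \<le> gsmul (m - n) l))
      else gsmul n (qc_rad \<delta>) + \<eta> \<le> gsmul m (qc_rad \<delta>) + \<eta>')"

(* omega_{a,delta}(f) <= omega_{a,delta}(g), with omega(0) = infinity *)
definition omega_le ::
  "('a::field \<Rightarrow> 'g::linordered_ab_group_add) \<Rightarrow> 'a \<Rightarrow> 'g qcut \<Rightarrow> 'a poly \<Rightarrow> 'a poly \<Rightarrow> bool" where
  "omega_le v a \<delta> f g \<longleftrightarrow> g = 0 \<or>
     (f \<noteq> 0 \<and> (\<exists>n. coeff (shift a f) n \<noteq> 0 \<and>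
        (\<forall>m. coeff (shift a g) m \<noteq> 0 \<longrightarrow>
           gd_le \<delta> (n, v (coeff (shift a f) n)) (m, v (coeff (shift a g) m)))))"

definition const_fr :: "'a::field \<Rightarrow> 'a poly fract" where
  "const_fr c = Fract [:c:] 1"

definition is_valuation_ring :: "'k::field set \<Rightarrow> bool" where
  "is_valuation_ring R \<longleftrightarrow> 0 \<in> R \<and> 1 \<in> R \<and>
     (\<forall>x\<in>R. \<forall>y\<in>R. x + y \<in> R \<and> x * y \<in> R \<and> - x \<in> R) \<and>
     (\<forall>z. z \<noteq> 0 \<longrightarrow> z \<in> R \<or> inverse z \<in> R)"

(* V(Kbar): classes of valuations of Kbar(x) extending vbar, represented by their valuation rings *)
definition VV :: "('a::field \<Rightarrow> 'g::linordered_ab_group_add) \<Rightarrow> 'a poly fract set set" where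
  "VV v = {R. is_valuation_ring R \<and> {c. const_fr c \<in> R} = {c. c = 0 \<or> 0 \<le> v c}}"

(* mu <= nu : equal classes, or for every nonzero f in Kbar[x] some gamma = v(c) with
   mu(f) <= gamma <= nu(f), i.e. c/f in O_mu and f/c in O_nu *)
definition VV_le :: "'a::field poly fract set \<Rightarrow> 'a poly fract set \<Rightarrow> bool" where
  "VV_le R1 R2 \<longleftrightarrow> R1 = R2 \<or>
     (\<forall>f :: 'a poly. f \<noteq> 0 \<longrightarrow> (\<exists>c. c \<noteq> 0 \<and> Fract [:c:] f \<in> R1 \<and> Fract f [:c:] \<in> R2))"

definition omega_ring :: "('a::field \<Rightarrow> 'g::linordered_ab_group_add) \<Rightarrow> 'a \<Rightarrow> 'g qcut \<Rightarrow> 'a poly fract set" where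
  "omega_ring v a \<delta> = {Fract p q | p q. q \<noteq> 0 \<and> omega_le v a \<delta> q p}"

(* omega_{a,gamma}(f) in Gamma for f nonzero *)
definition omega_cl :: "('a::field \<Rightarrow> 'g::linordered_ab_group_add) \<Rightarrow> 'a \<Rightarrow> 'g \<Rightarrow> 'a poly \<Rightarrow> 'g" where
  "omega_cl v a \<gamma> f = Min {v (coeff (shift a f) n) + gsmul n \<gamma> | n. coeff (shift a f) n \<noteq> 0}"

(* omega_B for a closed ball B (independent of the chosen centre and radius) *)
definition omega_ball :: "('a::field \<Rightarrow> 'g::linordered_ab_group_add) \<Rightarrow> 'a set \<Rightarrow> 'a poly \<Rightarrow> 'g" where
  "omega_ball v B f = (THE w. \<exists>a \<gamma>. B = cball_v v a \<gamma> \<and> w = omega_cl v a \<gamma> f)"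

(* a nest (B_i) of closed balls with radii in Gamma, strictly decreasing, empty intersection;
   represented by the set of its balls (a chain under inclusion) *)
definition is_nest :: "('a::field \<Rightarrow> 'g::linordered_ab_group_add) \<Rightarrow> 'a set set \<Rightarrow> bool" where
  "is_nest v N \<longleftrightarrow> N \<noteq> {} \<and> (\<forall>B\<in>N. \<exists>a \<gamma>. B = cball_v v a \<gamma>) \<and>
     (\<forall>B\<in>N. \<forall>B'\<in>N. B \<subseteq> B' \<or> B' \<subseteq> B) \<and> \<Inter>N = {}"

definition mutually_cofinal :: "'a set set \<Rightarrow> 'a set set \<Rightarrow> bool" where
  "mutually_cofinal N N' \<longleftrightarrow> (\<forall>B\<in>N. \<exists>B'\<in>N'. B' \<subseteq> B) \<and> (\<forall>B'\<in>N'. \<exists>B\<in>N. B \<subseteq> B')"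

(* omega_{\<B>}(f) = max_i omega_{B_i}(f) for f nonzero *)
definition omega_nest :: "('a::field \<Rightarrow> 'g::linordered_ab_group_add) \<Rightarrow> 'a set set \<Rightarrow> 'a poly \<Rightarrow> 'g" where
  "omega_nest v N f = (GREATEST w. w \<in> (\<lambda>B. omega_ball v B f) ` N)"

definition nest_ring :: "('a::field \<Rightarrow> 'g::linordered_ab_group_add) \<Rightarrow> 'a set set \<Rightarrow> 'a poly fract set" where
  "nest_ring v N = {Fract p q | p q. q \<noteq> 0 \<and> (p = 0 \<or> omega_nest v N q \<le> omega_nest v N p)}"

datatype ('a, 'g) bb_elem = BInf "'a set set set" | BPt "'a set" "'g qcut"

definition BB :: "('a::field \<Rightarrow> 'g::linordered_ab_group_add) \<Rightarrow> ('a, 'g) bb_elem set" where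
  "BB v = {BInf {N'. is_nest v N' \<and> mutually_cofinal N N'} | N. is_nest v N}
        \<union> {BPt (ball_v v a \<delta>) \<delta> | a \<delta>. is_qcut \<delta>}"

fun BB_le :: "('a, 'g::linorder) bb_elem \<Rightarrow> ('a, 'g) bb_elem \<Rightarrow> bool" where
  "BB_le (BPt B \<delta>) (BPt B' \<epsilon>) \<longleftrightarrow> B' \<subseteq> B \<and> qc_le \<delta> \<epsilon>"
| "BB_le (BPt B \<delta>) (BInf C) \<longleftrightarrow> (\<exists>N\<in>C. \<exists>Bi\<in>N. Bi \<subseteq> B)"
| "BB_le (BInf C) (BInf C') \<longleftrightarrow> C = C'"
| "BB_le (BInf C) (BPt B \<delta>) \<longleftrightarrow> False"

fun omega_map :: "('a::field \<Rightarrow> 'g::linordered_ab_group_add) \<Rightarrow> ('a, 'g) bb_elem \<Rightarrow> 'a poly fract set" where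
  "omega_map v (BPt B \<delta>) = omega_ring v (SOME a. B = ball_v v a \<delta>) \<delta>"
| "omega_map v (BInf C) = nest_ring v (SOME N. N \<in> C)"

end

theory Submission
  imports Defs
begin

text \<open>Since \<open>K\<close> is algebraically closed, everything is controlled by the values of linear polynomials. A
  valuation \<open>\<mu>\<close> on \<open>K(x)\<close> extending \<open>v\<close> assigns to each \<open>b\<close> the quasi-cut \<open>D(b)\<close> that \<open>\<mu>(x - b)\<close>
  determines in \<open>\<Gamma>\<close>, and \<open>D\<close> determines \<open>\<mu>\<close>: if every \<open>D(b)\<close> lies in \<open>\<Gamma>\<close>, every polynomial is a constant
  times a unit; if some \<open>D(a)\<close> is a proper cut, every polynomial is a constant times a power of \<open>x - a\<close> times
  a unit, and the divisibility of \<open>\<Gamma>\<close> decides which such monomials are integral. The order is likewise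
  pointwise comparison of the functions \<open>D\<close>.

  By Gauss's lemma \<open>\<omega>\<^sub>a\<^sub>,\<^sub>\<delta>\<close> is a valuation, with \<open>D(b) = min (v (a - b)) \<delta>\<close>. The valuation of a nest is
  \<open>f \<mapsto> v (f z)\<close> for \<open>z\<close> in any ball of the nest small enough to avoid the roots of \<open>f\<close>, so here
  \<open>D(b) = v (z - b)\<close>. Conversely, given \<open>\<mu>\<close>, either \<open>D\<close> attains a maximum at some \<open>a\<close>, and \<open>\<mu>\<close> is
  \<open>\<omega>\<^sub>a\<^sub>,\<^sub>D\<^sub>(\<^sub>a\<^sub>)\<close>, or it has no maximum; then every \<open>D(a)\<close> is an element of \<open>\<Gamma>\<close>, and the balls of centre \<open>a\<close>
  and radius \<open>D(a)\<close> form a nest whose valuation is \<open>\<mu>\<close>.\<close>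

section \<open>Quasi-cuts and the ordered group \<open>\<Gamma>(\<delta>)\<close>\<close>

lemma gsmul_0 [simp]: "gsmul 0 g = 0"
  by (simp add: gsmul_def)

lemma gsmul_Suc [simp]: "gsmul (Suc n) g = g + gsmul n g"
  by (simp add: gsmul_def add.commute)

lemma gsmul_add: "gsmul (n + m) g = gsmul n g + gsmul m g"
  by (induction n) (simp_all add: add.assoc)

lemma gsmul_mono:
  fixes s t :: "'g::linordered_ab_group_add"
  assumes "s \<le> t"
  shows "gsmul n s \<le> gsmul n t"
  using assms by (induction n) (simp_all add: add_mono)

text \<open>After cancellation only the surplus copies of the point remain, so raising it helps when
  they sit on the right and lowering it helps when they sit on the left.\<close>

lemma gsmul_le_move:
  fixes s t e e' :: "'g::linordered_ab_group_add"
  assumes "gsmul n s + e \<le> gsmul m s + e'" "n < m \<longrightarrow> s \<le> t" "m < n \<longrightarrow> t \<le> s"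
  shows "gsmul n t + e \<le> gsmul m t + e'"
proof (cases n m rule: linorder_cases)
  case less
  then obtain k where m: "m = n + k" by (metis less_imp_add_positive)
  have "e \<le> gsmul k s + e'" using assms(1) by (simp add: m gsmul_add add.assoc)
  also have "\<dots> \<le> gsmul k t + e'" using assms(2) less by (simp add: gsmul_mono)
  finally show ?thesis by (simp add: m gsmul_add add.assoc)
next
  case equal
  then show ?thesis using assms by simp
next
  case greater
  then obtain k where n: "n = m + k" by (metis less_imp_add_positive)
  have "gsmul k t + e \<le> gsmul k s + e" using assms(3) greater by (simp add: gsmul_mono)
  also have "\<dots> \<le> e'" using assms(1) by (simp add: n gsmul_add add.assoc)
  finally show ?thesis by (simp add: n gsmul_add add.assoc)
qed

lemma qcut_not_cutE:
  assumes "is_qcut \<delta>" "\<not> is_cut \<delta>"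
  obtains \<gamma> where "\<delta> = qc_of \<gamma>" "qc_rad \<delta> = \<gamma>"
proof -
  have le: "l \<le> r" if "l \<in> fst \<delta>" "r \<in> snd \<delta>" for l r
    using assms(1) that by (auto simp: is_qcut_def)
  have U: "t \<in> fst \<delta> \<or> t \<in> snd \<delta>" for t
    using assms(1) by (auto simp: is_qcut_def)
  obtain \<gamma> where g: "\<gamma> \<in> fst \<delta>" "\<gamma> \<in> snd \<delta>"
    using assms by (auto simp: is_cut_def)
  have "fst \<delta> = {..\<gamma>}"
  proof (intro set_eqI iffI)
    fix t assume "t \<in> fst \<delta>" then show "t \<in> {..\<gamma>}" using le g by auto
  next
    fix t assume "t \<in> {..\<gamma>}" then show "t \<in> fst \<delta>"
      using le[OF g(1), of t] g U[of t] by (cases "t = \<gamma>") auto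
  qed
  moreover have "snd \<delta> = {\<gamma>..}"
  proof (intro set_eqI iffI)
    fix t assume "t \<in> snd \<delta>" then show "t \<in> {\<gamma>..}" using le g by auto
  next
    fix t assume "t \<in> {\<gamma>..}" then show "t \<in> snd \<delta>"
      using le[OF _ g(2), of t] g U[of t] by (cases "t = \<gamma>") auto
  qed
  ultimately have "\<delta> = qc_of \<gamma>" by (simp add: qc_of_def prod_eq_iff)
  moreover have "qc_rad \<delta> = \<gamma>" unfolding qc_rad_def
    by (rule the_equality) (use g le in \<open>auto intro: antisym\<close>)
  ultimately show ?thesis by (rule that)
qed

lemma is_qcut_qc_of: "is_qcut (qc_of \<gamma>)"
  by (auto simp: is_qcut_def qc_of_def)

lemma qcut_up: "is_qcut \<delta> \<Longrightarrow> s \<in> snd \<delta> \<Longrightarrow> s \<le> t \<Longrightarrow> t \<in> snd \<delta>"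
  unfolding is_qcut_def by (metis UNIV_I UnE antisym)

lemma qcut_down: "is_qcut \<delta> \<Longrightarrow> t \<in> fst \<delta> \<Longrightarrow> s \<le> t \<Longrightarrow> s \<in> fst \<delta>"
  unfolding is_qcut_def by (metis UNIV_I UnE antisym)

text \<open>Evaluating both monomials at a point \<open>t\<close> on the appropriate side of the quasi-cut treats cuts
  and elements of \<open>\<Gamma>\<close> alike.\<close>

lemma gd_le_iff:
  fixes \<delta> :: "'g::linordered_ab_group_add qcut"
  assumes "is_qcut \<delta>"
  shows "gd_le \<delta> (n, e) (m, e') \<longleftrightarrow>
    (\<exists>t. (n < m \<longrightarrow> t \<in> fst \<delta>) \<and> (m < n \<longrightarrow> t \<in> snd \<delta>) \<and> gsmul n t + e \<le> gsmul m t + e')"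
proof (cases "is_cut \<delta>")
  case True
  show ?thesis
  proof (cases n m rule: linorder_cases)
    case less
    then obtain k where m: "m = n + k" by (metis less_imp_add_positive)
    show ?thesis using less True
      by (auto simp: gd_le_def m gsmul_add Bex_def algebra_simps)
  next
    case equal
    then show ?thesis using True by (simp add: gd_le_def)
  next
    case greater
    then obtain k where n: "n = m + k" by (metis less_imp_add_positive)
    show ?thesis using greater True
      by (auto simp: gd_le_def n gsmul_add Bex_def algebra_simps)
  qed
next
  case False
  obtain \<gamma> where g: "\<delta> = qc_of \<gamma>" "qc_rad \<delta> = \<gamma>" using qcut_not_cutE[OF assms False] by blast
  show ?thesis
  proof
    assume "gd_le \<delta> (n, e) (m, e')"
    then show "\<exists>t. (n < m \<longrightarrow> t \<in> fst \<delta>) \<and> (m < n \<longrightarrow> t \<in> snd \<delta>) \<and> gsmul n t + e \<le> gsmul m t + e'"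
      using False g by (intro exI[of _ \<gamma>]) (auto simp: gd_le_def qc_of_def)
  next
    assume "\<exists>t. (n < m \<longrightarrow> t \<in> fst \<delta>) \<and> (m < n \<longrightarrow> t \<in> snd \<delta>) \<and> gsmul n t + e \<le> gsmul m t + e'"
    then obtain t where t: "n < m \<longrightarrow> t \<in> fst \<delta>" "m < n \<longrightarrow> t \<in> snd \<delta>" "gsmul n t + e \<le> gsmul m t + e'"
      by blast
    have "gsmul n \<gamma> + e \<le> gsmul m \<gamma> + e'"
      by (rule gsmul_le_move[OF t(3)]) (use t(1,2) in \<open>auto simp: g(1) qc_of_def\<close>)
    then show "gd_le \<delta> (n, e) (m, e')" using False g by (simp add: gd_le_def)
  qed
qed

lemma gd_le_same: "gd_le \<delta> (n, e) (n, e') \<longleftrightarrow> e \<le> e'"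
  by (auto simp: gd_le_def)

text \<open>\<open>gd_le_iff\<close> turns each hypothesis into an inequality at a witness point; it
  remains to move both to one common point on an admissible side of the quasi-cut.\<close>

lemma gd_le_trans:
  fixes \<delta> :: "'g::linordered_ab_group_add qcut"
  assumes q: "is_qcut \<delta>" and 1: "gd_le \<delta> x y" and 2: "gd_le \<delta> y z"
  shows "gd_le \<delta> x z"
proof -
  obtain n e m e' p e'' where xyz: "x = (n, e)" "y = (m, e')" "z = (p, e'')"
    by (metis surj_pair)
  have le: "l \<le> r" if "l \<in> fst \<delta>" "r \<in> snd \<delta>" for l r
    using q that by (auto simp: is_qcut_def)
  obtain s where s: "n < m \<longrightarrow> s \<in> fst \<delta>" "m < n \<longrightarrow> s \<in> snd \<delta>" "gsmul n s + e \<le> gsmul m s + e'"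
    using 1 unfolding xyz gd_le_iff[OF q] by blast
  obtain t where t: "m < p \<longrightarrow> t \<in> fst \<delta>" "p < m \<longrightarrow> t \<in> snd \<delta>" "gsmul m t + e' \<le> gsmul p t + e''"
    using 2 unfolding xyz gd_le_iff[OF q] by blast
  have *: "gd_le \<delta> x z" if "n < m \<longrightarrow> s \<le> u" "m < n \<longrightarrow> u \<le> s"
      "m < p \<longrightarrow> t \<le> u" "p < m \<longrightarrow> u \<le> t" "n < p \<longrightarrow> u \<in> fst \<delta>" "p < n \<longrightarrow> u \<in> snd \<delta>" for u
  proof -
    have "gsmul n u + e \<le> gsmul m u + e'" by (rule gsmul_le_move[OF s(3) that(1,2)])
    also have "\<dots> \<le> gsmul p u + e''" by (rule gsmul_le_move[OF t(3) that(3,4)])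
    finally show ?thesis unfolding xyz gd_le_iff[OF q] using that(5,6) by blast
  qed
  \<comment> \<open>The common point is the maximum of the witnesses when the exponents increase and
    the minimum when they decrease. When the exponents turn, \<open>s\<close> and \<open>t\<close>
    lie on opposite sides of the quasi-cut, so \<open>le\<close> orders them.\<close>
  consider "n = m" | "m = p" | "n < m" "m < p" | "m < n" "p < m"
    | "m < n" "m < p" "p < n" | "m < n" "m < p" "n \<le> p"
    | "n < m" "p < m" "n < p" | "n < m" "p < m" "p \<le> n" by linarith
  then show ?thesis
  proof cases
    case 1
    show ?thesis by (rule *[of t]) (use 1 s t in simp_all)
  next
    case 2
    show ?thesis by (rule *[of s]) (use 2 s t in simp_all)
  next
    case 3
    show ?thesis by (rule *[of "max s t"]) (use 3 s(1) t(1) in \<open>auto simp: max_def\<close>)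
  next
    case 4
    show ?thesis by (rule *[of "min s t"]) (use 4 s(2) t(2) in \<open>auto simp: min_def\<close>)
  next
    case 5
    show ?thesis by (rule *[of s]) (use 5 s t le in simp_all)
  next
    case 6
    show ?thesis by (rule *[of t]) (use 6 s t le in simp_all)
  next
    case 7
    show ?thesis by (rule *[of s]) (use 7 s t le in simp_all)
  next
    case 8
    show ?thesis by (rule *[of t]) (use 8 s t le in simp_all)
  qed
qed

lemma gd_le_add_right:
  assumes q: "is_qcut \<delta>"
  shows "gd_le \<delta> (n + k, e + d) (m + k, e' + d) \<longleftrightarrow> gd_le \<delta> (n, e) (m, e')"
proof -
  have "gsmul (n + k) t + (e + d) \<le> gsmul (m + k) t + (e' + d) \<longleftrightarrow> gsmul n t + e \<le> gsmul m t + e'" for t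
  proof -
    have "gsmul (n + k) t + (e + d) = (gsmul n t + e) + (gsmul k t + d)"
      "gsmul (m + k) t + (e' + d) = (gsmul m t + e') + (gsmul k t + d)"
      by (simp_all add: gsmul_add algebra_simps)
    then show ?thesis by simp
  qed
  then show ?thesis by (simp add: gd_le_iff[OF q])
qed

text \<open>Monomials of different exponents agree at the point obtained by dividing the difference
  of the constants by that of the exponents; the side of the quasi-cut containing this point decides
  the comparison.\<close>

lemma gd_le_total:
  fixes \<delta> :: "'g::linordered_ab_group_add qcut"
  assumes q: "is_qcut \<delta>" and div: "\<And>k (t::'g). 0 < k \<Longrightarrow> \<exists>s. gsmul k s = t"
  shows "gd_le \<delta> (n, e) (m, e') \<or> gd_le \<delta> (m, e') (n, e)"
proof -
  have U: "t \<in> fst \<delta> \<or> t \<in> snd \<delta>" for t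
    using q by (auto simp: is_qcut_def)
  have *: "gd_le \<delta> (n, e) (m, e') \<or> gd_le \<delta> (m, e') (n, e)" if "n < m" for n m e e'
  proof -
    obtain k where m: "m = n + k" "0 < k" using \<open>n < m\<close> by (metis less_imp_add_positive)
    obtain s where s: "gsmul k s = e - e'" using div m(2) by blast
    have "gsmul n s + e = gsmul m s + e'" by (simp add: m gsmul_add s algebra_simps)
    then show ?thesis using U[of s] that by (auto simp: gd_le_iff[OF q] intro!: exI[of _ s])
  qed
  show ?thesis using *[of n m] *[of m n] by (cases n m rule: linorder_cases) (auto simp: gd_le_same)
qed

lemma finite_preorder_min:
  assumes "finite A" "A \<noteq> {}"
    and "\<And>x y. r x y \<or> r y x" "\<And>x y z. r x y \<Longrightarrow> r y z \<Longrightarrow> r x z"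
  shows "\<exists>x\<in>A. \<forall>y\<in>A. r x y"
  using assms(1,2)
proof (induction rule: finite_ne_induct)
  case (singleton x)
  then show ?case using assms(3) by blast
next
  case (insert x F)
  then show ?case using assms(3,4) by (metis insert_iff)
qed

section \<open>Valuation rings\<close>

text \<open>Divisibility in \<open>R\<close> is the comparison mu(x) <= mu(y) of the associated
  valuation; stated without quotients it also covers zero, whose value is infinity.\<close>

definition vle :: "'k::field set \<Rightarrow> 'k \<Rightarrow> 'k \<Rightarrow> bool" where
  "vle R x y \<longleftrightarrow> (\<exists>r\<in>R. y = r * x)"

lemma vle_iff_divide: "x \<noteq> 0 \<Longrightarrow> vle R x y \<longleftrightarrow> y / x \<in> R"
  unfolding vle_def by (metis nonzero_divide_eq_eq)

context
  fixes R :: "'k::field set"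
  assumes R: "is_valuation_ring R"
begin

lemma vle_refl: "vle R x x"
  using R unfolding vle_def is_valuation_ring_def by (metis mult_1)

lemma vle_0: "vle R x 0"
  using R unfolding vle_def is_valuation_ring_def by (metis mult_zero_left)

lemma vle_trans: "vle R x y \<Longrightarrow> vle R y z \<Longrightarrow> vle R x z"
  using R unfolding vle_def is_valuation_ring_def by (metis mult.assoc)

lemma vle_total: "vle R x y \<or> vle R y x"
proof (cases "x = 0 \<or> y = 0")
  case True
  then show ?thesis using vle_0 by blast
next
  case False
  then have "y / x \<in> R \<or> inverse (y / x) \<in> R"
    using R unfolding is_valuation_ring_def by metis
  then show ?thesis using False by (simp add: vle_iff_divide)
qed

lemma vle_add: "vle R x y \<Longrightarrow> vle R x z \<Longrightarrow> vle R x (y + z)"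
  using R unfolding vle_def is_valuation_ring_def by (metis distrib_right)

lemma vle_minus: "vle R x y \<Longrightarrow> vle R x (- y)"
  using R unfolding vle_def is_valuation_ring_def by (metis mult_minus_left)

lemma vle_diff: "vle R x y \<Longrightarrow> vle R x z \<Longrightarrow> vle R x (y - z)"
  using vle_add[of x y "- z"] vle_minus[of x z] by simp

lemma vle_mult: "vle R x y \<Longrightarrow> vle R z w \<Longrightarrow> vle R (x * z) (y * w)"
proof -
  assume "vle R x y" "vle R z w"
  then obtain r s where "r \<in> R" "s \<in> R" "y = r * x" "w = s * z" by (auto simp: vle_def)
  moreover have "r * s \<in> R" using R calculation by (auto simp: is_valuation_ring_def)
  ultimately show ?thesis unfolding vle_def by (intro bexI[of _ "r * s"]) (simp_all add: mult_ac)
qed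

lemma vle_cancel: "z \<noteq> 0 \<Longrightarrow> vle R (x * z) (y * z) \<longleftrightarrow> vle R x y"
  by (auto simp: vle_def)

lemma vle_power: "vle R x y \<Longrightarrow> vle R (x ^ n) (y ^ n)"
  by (induction n) (auto intro: vle_mult vle_refl)

lemma vle_power_iff:
  assumes "0 < n"
  shows "vle R (x ^ n) (y ^ n) \<longleftrightarrow> vle R x y"
proof
  assume a: "vle R (x ^ n) (y ^ n)"
  show "vle R x y"
  proof (rule ccontr)
    assume n: "\<not> vle R x y"
    then have yx: "vle R y x" using vle_total by blast
    obtain k where k: "n = Suc k" using assms by (cases n) auto
    have y0: "y \<noteq> 0" using n vle_0 by auto
    \<comment> \<open>Since mu(y) <= mu(x), the product \<open>x * y ^ k\<close> lies below
      \<open>x ^ n\<close>, hence below \<open>y ^ n\<close>, and \<open>y ^ k\<close>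
      cancels.\<close>
    have "vle R (x * y ^ k) (x * x ^ k)" using vle_mult vle_refl vle_power yx by blast
    then have "vle R (x * y ^ k) (y * y ^ k)" using a by (simp add: k vle_trans)
    then have "vle R x y" using y0 by (simp add: vle_cancel)
    then show False using n by blast
  qed
qed (rule vle_power)

text \<open>The one of \<open>y\<close> and \<open>z\<close> with the smaller value divides the sum,
  hence would divide \<open>x\<close> too.\<close>

lemma vle_add_strict:
  assumes "\<not> vle R y x" "\<not> vle R z x"
  shows "\<not> vle R (y + z) x"
proof
  assume a: "vle R (y + z) x"
  from vle_total[of y z] show False
  proof
    assume "vle R y z"
    then have "vle R y (y + z)" by (intro vle_add vle_refl)
    then show False using a assms(1) vle_trans by blast
  next
    assume "vle R z y"
    then have "vle R z (y + z)" by (intro vle_add vle_refl)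
    then show False using a assms(2) vle_trans by blast
  qed
qed

lemma vle_add_dominated:
  assumes "\<not> vle R y x"
  shows "vle R x (x + y)" "vle R (x + y) x"
proof -
  have "vle R x y" using assms vle_total by blast
  then show "vle R x (x + y)" by (intro vle_add vle_refl)
  have "\<not> vle R (- y) x"
    using assms vle_trans[OF vle_minus[OF vle_refl]] by blast
  then show "vle R (x + y) x"
    using vle_add_strict[of "x + y" x "- y"] vle_refl[of x] by auto
qed

end

text \<open>\<open>W f g\<close> stands for mu(f) <= mu(g) on a domain, so that no value group has
  to be constructed. The nonzero side conditions are there because a comparison defined through
  values may be meaningless at zero.\<close>

locale valuation_preorder =
  fixes W :: "'b::idom \<Rightarrow> 'b \<Rightarrow> bool"
  assumes total: "f \<noteq> 0 \<Longrightarrow> g \<noteq> 0 \<Longrightarrow> W f g \<or> W g f"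
    and trans: "f \<noteq> 0 \<Longrightarrow> g \<noteq> 0 \<Longrightarrow> h \<noteq> 0 \<Longrightarrow> W f g \<Longrightarrow> W g h \<Longrightarrow> W f h"
    and zero: "W f 0"
    and add: "f \<noteq> 0 \<Longrightarrow> W f g \<Longrightarrow> W f h \<Longrightarrow> W f (g + h)"
    and minus: "f \<noteq> 0 \<Longrightarrow> W f g \<Longrightarrow> W f (- g)"
    and cancel: "f \<noteq> 0 \<Longrightarrow> h \<noteq> 0 \<Longrightarrow> W (f * h) (g * h) \<longleftrightarrow> W f g"
begin

definition "ring_of = {Fract p q | p q. q \<noteq> 0 \<and> W q p}"

text \<open>Cancellation makes membership independent of the chosen fraction; sums then reduce to a
  common denominator and inverses to totality.\<close>

lemma ring_of_valuation_ring: "is_valuation_ring ring_of"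
  and Fract_in_ring_of: "\<And>p q. q \<noteq> 0 \<Longrightarrow> Fract p q \<in> ring_of \<longleftrightarrow> W q p"
proof -
  show mem: "Fract p q \<in> ring_of \<longleftrightarrow> W q p" if "q \<noteq> 0" for p q
  proof
    assume "Fract p q \<in> ring_of"
    then obtain p' q' where *: "q' \<noteq> 0" "W q' p'" "Fract p q = Fract p' q'"
      unfolding ring_of_def by blast
    then have eq: "p * q' = p' * q" using that by (simp add: eq_fract)
    have "W (q' * q) (p' * q)" using * that cancel by blast
    then have "W (q * q') (p * q')" by (simp add: eq mult.commute)
    then show "W q p" using * that cancel by blast
  qed (use that in \<open>auto simp: ring_of_def\<close>)
  have refl: "W f f" if "f \<noteq> 0" for f using total that by blast
  have mult: "W (q * q') (p * p')" if "q \<noteq> 0" "q' \<noteq> 0" "W q p" "W q' p'" for p q p' q'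
  proof (cases "p = 0 \<or> p' = 0")
    case True
    then show ?thesis using zero by auto
  next
    case False
    have "W (q * q') (p * q')" using that cancel by blast
    moreover have "W (q' * p) (p' * p)" using that cancel False by blast
    ultimately show ?thesis using trans[of "q * q'" "p * q'" "p * p'"] that False by (simp add: mult_ac)
  qed
  show "is_valuation_ring ring_of"
    unfolding is_valuation_ring_def
  proof (intro conjI ballI allI impI)
    show "0 \<in> ring_of" using mem[of 1 0] zero by (simp add: Zero_fract_def)
    show "1 \<in> ring_of" using mem[of 1 1] refl by (simp add: One_fract_def)
  next
    fix x y assume xy: "x \<in> ring_of" "y \<in> ring_of"
    obtain p q where x: "x = Fract p q" "q \<noteq> 0" "W q p" using xy(1) unfolding ring_of_def by blast
    obtain p' q' where y: "y = Fract p' q'" "q' \<noteq> 0" "W q' p'" using xy(2) unfolding ring_of_def by blast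
    show "x * y \<in> ring_of" using x y mult mem by simp
    show "- x \<in> ring_of" using x minus mem by simp
    have "W (q * q') (p * q')" "W (q * q') (p' * q)"
      using x y cancel[of q q' p] cancel[of q' q p'] by (auto simp: mult.commute)
    then show "x + y \<in> ring_of" using x y add mem by simp
  next
    fix z :: "'b fract" assume "z \<noteq> 0"
    obtain p q where z: "z = Fract p q" "q \<noteq> 0" by (cases z)
    have "p \<noteq> 0" using \<open>z \<noteq> 0\<close> z by (auto simp: fract_collapse)
    then show "z \<in> ring_of \<or> inverse z \<in> ring_of" using z total mem by simp
  qed
qed

end

section \<open>Gauss's lemma\<close>

text \<open>The value of \<open>f\<close> would live in the group extended by x_delta. The exponent
  of a least monomial stands in for it, since values are only ever compared.\<close>

definition min_mon :: "('a::field \<Rightarrow> 'g::linordered_ab_group_add) \<Rightarrow> 'g qcut \<Rightarrow> 'a poly \<Rightarrow> nat \<Rightarrow> bool" where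
  "min_mon v \<delta> f n \<longleftrightarrow> coeff f n \<noteq> 0 \<and>
     (\<forall>m. coeff f m \<noteq> 0 \<longrightarrow> gd_le \<delta> (n, v (coeff f n)) (m, v (coeff f m)))"

lemma shift_0 [simp]: "shift a 0 = 0"
  by (simp add: shift_def)

lemma shift_mult: "shift a (f * g) = shift a f * shift a g"
  by (simp add: shift_def pcompose_mult)

lemma shift_add: "shift a (f + g) = shift a f + shift a g"
  by (simp add: shift_def pcompose_add)

lemma shift_minus: "shift a (- f) = - shift a f"
  by (simp add: shift_def pcompose_uminus)

lemma shift_eq_0_iff [simp]: "shift a f = 0 \<longleftrightarrow> f = 0"
  by (simp add: shift_def pcompose_eq_0_iff)

lemma shift_const [simp]: "shift a [:c:] = [:c:]"
  by (simp add: shift_def pcompose_pCons)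

lemma shift_linear [simp]: "shift a [:- b, 1:] = [:a - b, 1:]"
  by (simp add: shift_def pcompose_pCons)

lemma coeff_const_if: "coeff [:c:] n = (if n = 0 then c else 0)"
  by (simp add: coeff_pCons split: nat.split)

lemma coeff_linear_if: "coeff [:c, d:] n = (if n = 0 then c else if n = Suc 0 then d else 0)"
  by (auto simp: coeff_pCons split: nat.split)

section \<open>Ultrametric rules and factorisation over an algebraically closed valued field\<close>

locale alg_closed_valued =
  fixes v :: "'a::field \<Rightarrow> 'g::linordered_ab_group_add"
  assumes closed: "alg_closed TYPE('a)"
    and val: "is_valuation v"
    and onto: "\<forall>\<gamma>. \<exists>x. x \<noteq> 0 \<and> v x = \<gamma>"
begin

lemma v_mult: "x \<noteq> 0 \<Longrightarrow> y \<noteq> 0 \<Longrightarrow> v (x * y) = v x + v y"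
  using val by (simp add: is_valuation_def)

lemma v_add: "x \<noteq> 0 \<Longrightarrow> y \<noteq> 0 \<Longrightarrow> x + y \<noteq> 0 \<Longrightarrow> min (v x) (v y) \<le> v (x + y)"
  using val by (simp add: is_valuation_def)

lemma v_1 [simp]: "v 1 = 0"
  using v_mult[of 1 1] by simp

lemma v_minus [simp]: "v (- x) = v x"
proof (cases "x = 0")
  case False
  have "v (-1) + v (-1) = 0" using v_mult[of "-1" "-1"] by simp
  then have "v (-1) = 0" by simp
  then show ?thesis using v_mult[of "-1" x] False by simp
qed simp

lemma v_minus_commute: "v (x - y) = v (y - x)"
  using v_minus[of "x - y"] by simp

lemma v_inverse: "x \<noteq> 0 \<Longrightarrow> v (inverse x) = - v x"
  using v_mult[of x "inverse x"] by (simp add: eq_neg_iff_add_eq_0 add.commute)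

lemma v_divide: "x \<noteq> 0 \<Longrightarrow> y \<noteq> 0 \<Longrightarrow> v (x / y) = v x - v y"
  using v_mult[of x "inverse y"] v_inverse by (simp add: divide_inverse)

lemma v_power: "x \<noteq> 0 \<Longrightarrow> v (x ^ n) = gsmul n (v x)"
  by (induction n) (simp_all add: v_mult)

lemma v_add_ge:
  assumes "x = 0 \<or> \<gamma> \<le> v x" "y = 0 \<or> \<gamma> \<le> v y"
  shows "x + y = 0 \<or> \<gamma> \<le> v (x + y)"
  using assms v_add[of x y] by (cases "x = 0"; cases "y = 0") (auto intro: order_trans[of \<gamma> "min (v x) (v y)"])

lemma v_diff_ge:
  assumes "x = 0 \<or> \<gamma> \<le> v x" "y = 0 \<or> \<gamma> \<le> v y"
  shows "x - y = 0 \<or> \<gamma> \<le> v (x - y)"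
  using v_add_ge[of x \<gamma> "- y"] assms by simp

lemma v_add_gt:
  assumes "x = 0 \<or> \<gamma> < v x" "y = 0 \<or> \<gamma> < v y"
  shows "x + y = 0 \<or> \<gamma> < v (x + y)"
  using assms v_add[of x y] by (cases "x = 0"; cases "y = 0") (auto intro: less_le_trans[of \<gamma> "min (v x) (v y)"])

lemma v_add_eq:
  assumes "x \<noteq> 0" "y = 0 \<or> v x < v y"
  shows "x + y \<noteq> 0" "v (x + y) = v x"
proof -
  show nz: "x + y \<noteq> 0"
    using assms by (metis add_eq_0_iff less_irrefl v_minus add.right_neutral)
  have "v x \<le> v (x + y)" using v_add_ge[of x "v x" y] assms nz by (auto dest: less_imp_le)
  moreover have "\<not> v x < v (x + y)"
    using v_add_gt[of "x + y" "v x" "- y"] assms by auto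
  ultimately show "v (x + y) = v x" by simp
qed

lemma v_sum_gt:
  assumes "\<And>i. i \<in> A \<Longrightarrow> f i = 0 \<or> \<gamma> < v (f i)"
  shows "sum f A = 0 \<or> \<gamma> < v (sum f A)"
  using assms
proof (induction A rule: infinite_finite_induct)
  case (insert x F)
  then show ?case using v_add_gt[of "f x" \<gamma> "sum f F"] by simp
qed simp_all

text \<open>If every nonzero term had value above that of the sum, so would the sum itself.\<close>

lemma v_sum_witness:
  assumes "sum f A \<noteq> 0"
  shows "\<exists>i\<in>A. f i \<noteq> 0 \<and> v (f i) \<le> v (sum f A)"
  using v_sum_gt[of A f "v (sum f A)"] assms by (meson leI less_irrefl)

lemma root_exists:
  assumes "0 < n"
  shows "\<exists>y. y ^ n = (x::'a)"
proof -
  let ?p = "monom 1 n + [:- x:]"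
  have "degree ?p = n"
    using assms by (subst degree_add_eq_left) (simp_all add: degree_monom_eq)
  then obtain y where "poly ?p y = 0" using closed assms unfolding alg_closed_def by metis
  then show ?thesis by (auto simp: poly_monom intro!: exI[of _ y])
qed

text \<open>An element of value \<open>t\<close> has an \<open>n\<close>-th root, whose value is
  \<open>t\<close> divided by \<open>n\<close>.\<close>

lemma gsmul_divisible: "0 < n \<Longrightarrow> \<exists>s. gsmul n s = (t::'g)"
  using onto root_exists[of n] v_power by (metis power_0_left zero_less_iff_neq_zero)

text \<open>Roots are split off one at a time. Multiplicative statements thereby reduce to constants
  and monic linear factors.\<close>

lemma poly_factor_induct [consumes 1, case_names const linear]:
  assumes "f \<noteq> 0"
    and "\<And>c. c \<noteq> 0 \<Longrightarrow> P [:c:]"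
    and "\<And>b f. f \<noteq> 0 \<Longrightarrow> P f \<Longrightarrow> P ([:- b, 1:] * f)"
  shows "P (f :: 'a poly)"
  using assms(1)
proof (induction "degree f" arbitrary: f)
  case 0
  then obtain c where "f = [:c:]" using degree_eq_zeroE by metis
  then show ?case using assms(2) 0 by simp
next
  case (Suc n)
  then obtain b where "poly f b = 0" using closed unfolding alg_closed_def by (metis zero_less_Suc)
  then obtain g where g: "f = [:- b, 1:] * g" by (metis poly_eq_0_iff_dvd dvd_def)
  then have g0: "g \<noteq> 0" using Suc.prems by auto
  have "degree f = degree g + 1" unfolding g using g0 by (subst degree_mult_eq) auto
  then show ?case using Suc g g0 assms(3) by simp
qed

context
  fixes \<delta> :: "'g qcut"
  assumes q: "is_qcut \<delta>"
begin

lemma gd_le_total': "gd_le \<delta> x y \<or> gd_le \<delta> y x"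
  using gd_le_total[OF q gsmul_divisible] by (metis surj_pair)

lemma gd_le_refl: "gd_le \<delta> x x"
  using gd_le_total' by blast

lemma min_mon_exists:
  assumes "f \<noteq> 0"
  shows "\<exists>n. min_mon v \<delta> f n"
proof -
  have "finite {n. coeff f n \<noteq> 0}"
    by (rule finite_subset[of _ "{..degree f}"]) (auto simp: le_degree)
  moreover have "{n. coeff f n \<noteq> 0} \<noteq> {}" using assms by (auto intro!: exI[of _ "degree f"])
  ultimately have "\<exists>n\<in>{n. coeff f n \<noteq> 0}. \<forall>m\<in>{n. coeff f n \<noteq> 0}.
      gd_le \<delta> (n, v (coeff f n)) (m, v (coeff f m))"
    by (rule finite_preorder_min) (use gd_le_total' gd_le_trans[OF q] in blast)+
  then show ?thesis unfolding min_mon_def by blast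
qed

lemma gd_le_add2:
  assumes "gd_le \<delta> (n, e) (n', e')" "gd_le \<delta> (m, d) (m', d')"
  shows "gd_le \<delta> (n + m, e + d) (n' + m', e' + d')"
proof (rule gd_le_trans[OF q])
  show "gd_le \<delta> (n + m, e + d) (n' + m, e' + d)" using assms(1) gd_le_add_right[OF q] by blast
  show "gd_le \<delta> (n' + m, e' + d) (n' + m', e' + d')"
    using assms(2) gd_le_add_right[OF q, of m n' d e' m' d'] by (simp add: add.commute)
qed

text \<open>A reverse comparison of the sums would survive enlarging \<open>(m, d)\<close> to
  \<open>(m', d')\<close>, and cancelling that pair contradicts strictness.\<close>

lemma gd_le_add_strict:
  assumes "\<not> gd_le \<delta> (n', e') (n, e)" "gd_le \<delta> (m, d) (m', d')"
  shows "\<not> gd_le \<delta> (n' + m', e' + d') (n + m, e + d)"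
proof
  assume a: "gd_le \<delta> (n' + m', e' + d') (n + m, e + d)"
  have "gd_le \<delta> (n + m, e + d) (n + m', e + d')" using assms(2) gd_le_add2 gd_le_refl by blast
  then have "gd_le \<delta> (n' + m', e' + d') (n + m', e + d')" using a gd_le_trans[OF q] by blast
  then show False using assms(1) gd_le_add_right[OF q] by blast
qed

text \<open>Taking the smallest minimising exponents makes every other term contributing
  to the coefficient of their sum strictly larger.\<close>

lemma min_mon_mult:
  assumes "f \<noteq> 0" "g \<noteq> 0"
  defines "n \<equiv> LEAST n. min_mon v \<delta> f n" and "m \<equiv> LEAST m. min_mon v \<delta> g m"
  shows "min_mon v \<delta> (f * g) (n + m)"
    and "v (coeff (f * g) (n + m)) = v (coeff f n) + v (coeff g m)"
proof -
  have n: "min_mon v \<delta> f n" unfolding n_def by (rule LeastI_ex[OF min_mon_exists[OF assms(1)]])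
  have m: "min_mon v \<delta> g m" unfolding m_def by (rule LeastI_ex[OF min_mon_exists[OF assms(2)]])
  have n_less: "\<not> gd_le \<delta> (i, v (coeff f i)) (n, v (coeff f n))" if "i < n" "coeff f i \<noteq> 0" for i
  proof
    assume "gd_le \<delta> (i, v (coeff f i)) (n, v (coeff f n))"
    then have "min_mon v \<delta> f i" using n that(2) gd_le_trans[OF q] unfolding min_mon_def by blast
    then show False using that(1) not_less_Least unfolding n_def by blast
  qed
  have m_less: "\<not> gd_le \<delta> (i, v (coeff g i)) (m, v (coeff g m))" if "i < m" "coeff g i \<noteq> 0" for i
  proof
    assume "gd_le \<delta> (i, v (coeff g i)) (m, v (coeff g m))"
    then have "min_mon v \<delta> g i" using m that(2) gd_le_trans[OF q] unfolding min_mon_def by blast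
    then show False using that(1) not_less_Least unfolding m_def by blast
  qed
  let ?t = "\<lambda>i. coeff f i * coeff g (n + m - i)"
  have fn: "coeff f n \<noteq> 0" and gm: "coeff g m \<noteq> 0" using n m by (auto simp: min_mon_def)
  \<comment> \<open>The term from the two least minimal exponents is isolated; the others will turn
    out strictly larger in value, so nothing cancels it.\<close>
  have c: "coeff (f * g) (n + m) = ?t n + sum ?t ({..n + m} - {n})"
    unfolding coeff_mult by (subst sum.remove[of _ n]) auto
  have tn: "?t n \<noteq> 0" "v (?t n) = v (coeff f n) + v (coeff g m)" using fn gm by (simp_all add: v_mult)
  have "?t i = 0 \<or> v (?t n) < v (?t i)" if "i \<in> {..n + m} - {n}" for i
  proof (cases "?t i = 0")
    case False
    then have fi: "coeff f i \<noteq> 0" and gi: "coeff g (n + m - i) \<noteq> 0" by auto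
    have i: "i + (n + m - i) = n + m" using that by simp
    \<comment> \<open>For \<open>i < n\<close> strictness comes from the choice of \<open>n\<close>;
      for \<open>i > n\<close> the complementary exponent is below \<open>m\<close>, and the choice
      of \<open>m\<close> gives it.\<close>
    have "\<not> gd_le \<delta> (n + m, v (?t i)) (n + m, v (?t n))"
    proof (cases "i < n")
      case True
      have "\<not> gd_le \<delta> (i + (n + m - i), v (coeff f i) + v (coeff g (n + m - i))) (n + m, v (coeff f n) + v (coeff g m))"
        by (rule gd_le_add_strict[OF n_less[OF True fi]]) (use m gi in \<open>simp add: min_mon_def\<close>)
      then show ?thesis using i tn fi gi by (simp add: v_mult)
    next
      case F: False
      then have "n + m - i < m" using that by auto
      from m_less[OF this gi]
      have "\<not> gd_le \<delta> ((n + m - i) + i, v (coeff g (n + m - i)) + v (coeff f i)) (m + n, v (coeff g m) + v (coeff f n))"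
        by (rule gd_le_add_strict) (use n fi in \<open>simp add: min_mon_def\<close>)
      then show ?thesis using i tn fi gi by (simp add: v_mult add.commute)
    qed
    then show ?thesis by (simp add: gd_le_same not_le)
  qed simp
  then have "sum ?t ({..n + m} - {n}) = 0 \<or> v (?t n) < v (sum ?t ({..n + m} - {n}))"
    by (rule v_sum_gt)
  then have *: "coeff (f * g) (n + m) \<noteq> 0" "v (coeff (f * g) (n + m)) = v (?t n)"
    using v_add_eq[OF tn(1)] unfolding c by auto
  show v: "v (coeff (f * g) (n + m)) = v (coeff f n) + v (coeff g m)" using * tn by simp
  show "min_mon v \<delta> (f * g) (n + m)"
    unfolding min_mon_def
  proof (intro conjI allI impI)
    show "coeff (f * g) (n + m) \<noteq> 0" by (rule *(1))
    fix k assume k: "coeff (f * g) k \<noteq> 0"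
    \<comment> \<open>Some product contributing to this coefficient has value at most that of the
      coefficient, and the minimal monomials of the factors bound the product from below.\<close>
    then obtain i where i: "i \<le> k" "coeff f i * coeff g (k - i) \<noteq> 0"
      "v (coeff f i * coeff g (k - i)) \<le> v (coeff (f * g) k)"
      using v_sum_witness[of "\<lambda>i. coeff f i * coeff g (k - i)" "{..k}"] by (auto simp: coeff_mult)
    have "gd_le \<delta> (n + m, v (coeff f n) + v (coeff g m)) (i + (k - i), v (coeff f i) + v (coeff g (k - i)))"
      using n m i by (intro gd_le_add2) (auto simp: min_mon_def)
    moreover have "gd_le \<delta> (i + (k - i), v (coeff f i) + v (coeff g (k - i))) (k, v (coeff (f * g) k))"
      using i by (simp add: gd_le_same v_mult)
    ultimately show "gd_le \<delta> (n + m, v (coeff (f * g) (n + m))) (k, v (coeff (f * g) k))"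
      unfolding v by (rule gd_le_trans[OF q])
  qed
qed

lemma omega_le_iff_min_mon:
  assumes "f \<noteq> 0" "g \<noteq> 0" "min_mon v \<delta> (shift a f) n" "min_mon v \<delta> (shift a g) m"
  shows "omega_le v a \<delta> f g \<longleftrightarrow> gd_le \<delta> (n, v (coeff (shift a f) n)) (m, v (coeff (shift a g) m))"
  using assms gd_le_trans[OF q] unfolding omega_le_def min_mon_def by blast

text \<open>By Gauss's lemma, multiplication by \<open>h\<close> adds the same exponent and the same
  value to the minimal monomials of both sides, where they cancel.\<close>

lemma omega_le_cancel:
  assumes "f \<noteq> 0" "h \<noteq> 0"
  shows "omega_le v a \<delta> (f * h) (g * h) \<longleftrightarrow> omega_le v a \<delta> f g"
proof (cases "g = 0")
  case True
  then show ?thesis by (simp add: omega_le_def)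
next
  case False
  let ?L = "\<lambda>f. LEAST n. min_mon v \<delta> (shift a f) n"
  have L: "min_mon v \<delta> (shift a f) (?L f)" if "f \<noteq> 0" for f
    by (rule LeastI_ex[OF min_mon_exists]) (use that in simp)
  have M: "min_mon v \<delta> (shift a (f * h)) (?L f + ?L h)"
    "v (coeff (shift a (f * h)) (?L f + ?L h)) = v (coeff (shift a f) (?L f)) + v (coeff (shift a h) (?L h))"
    if "f \<noteq> 0" for f
    using min_mon_mult[of "shift a f" "shift a h"] that assms by (simp_all add: shift_mult)
  have "omega_le v a \<delta> (f * h) (g * h) \<longleftrightarrow>
     gd_le \<delta> (?L f + ?L h, v (coeff (shift a f) (?L f)) + v (coeff (shift a h) (?L h)))
       (?L g + ?L h, v (coeff (shift a g) (?L g)) + v (coeff (shift a h) (?L h)))"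
    using omega_le_iff_min_mon[OF _ _ M(1) M(1)] M(2) assms False by simp
  also have "\<dots> \<longleftrightarrow> omega_le v a \<delta> f g"
    using omega_le_iff_min_mon[OF _ _ L L] assms False by (simp add: gd_le_add_right[OF q])
  finally show ?thesis .
qed

lemma omega_le_add:
  assumes f: "f \<noteq> 0" and g: "omega_le v a \<delta> f g" and h: "omega_le v a \<delta> f h"
  shows "omega_le v a \<delta> f (g + h)"
proof (cases "g = 0 \<or> h = 0 \<or> g + h = 0")
  case True
  then show ?thesis using assms by (auto simp: omega_le_def)
next
  case False
  obtain n where n: "min_mon v \<delta> (shift a f) n" using min_mon_exists f by (metis shift_eq_0_iff)
  have *: "gd_le \<delta> (n, v (coeff (shift a f) n)) (m, v (coeff (shift a g) m))"
    if "omega_le v a \<delta> f g" "coeff (shift a g) m \<noteq> 0" for g m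
  proof -
    from that(2) have "g \<noteq> 0" by auto
    with that obtain n' where "coeff (shift a f) n' \<noteq> 0"
      "gd_le \<delta> (n', v (coeff (shift a f) n')) (m, v (coeff (shift a g) m))"
      unfolding omega_le_def by blast
    then show ?thesis using n gd_le_trans[OF q] unfolding min_mon_def by blast
  qed
  have "gd_le \<delta> (n, v (coeff (shift a f) n)) (m, v (coeff (shift a (g + h)) m))"
    if m: "coeff (shift a (g + h)) m \<noteq> 0" for m
  proof -
    let ?x = "coeff (shift a g) m" and ?y = "coeff (shift a h) m"
    have s: "coeff (shift a (g + h)) m = ?x + ?y" by (simp add: shift_add)
    \<comment> \<open>By the ultrametric inequality one of the two coefficients has value at most
      that of the sum, and it is already bounded below by the minimal monomial of
      \<open>f\<close>.\<close>
    have "(?x \<noteq> 0 \<and> v ?x \<le> v (?x + ?y)) \<or> (?y \<noteq> 0 \<and> v ?y \<le> v (?x + ?y))"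
      using v_add_gt[of ?x "v (?x + ?y)" ?y] m unfolding s by (meson less_irrefl not_le)
    then show ?thesis
    proof
      assume "?x \<noteq> 0 \<and> v ?x \<le> v (?x + ?y)"
      then show ?thesis unfolding s
        by (intro gd_le_trans[OF q *[OF g, of m]]) (auto simp: gd_le_same)
    next
      assume "?y \<noteq> 0 \<and> v ?y \<le> v (?x + ?y)"
      then show ?thesis unfolding s
        by (intro gd_le_trans[OF q *[OF h, of m]]) (auto simp: gd_le_same)
    qed
  qed
  then show ?thesis using n f unfolding omega_le_def min_mon_def by blast
qed

lemma omega_le_valuation_preorder: "valuation_preorder (omega_le v a \<delta>)"
proof
  fix f g h :: "'a poly"
  have ex: "\<exists>n. min_mon v \<delta> (shift a f) n" if "f \<noteq> 0" for f
    using min_mon_exists that by (metis shift_eq_0_iff)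
  show "omega_le v a \<delta> f g \<or> omega_le v a \<delta> g f" if fg: "f \<noteq> 0" "g \<noteq> 0"
  proof -
    obtain n m where "min_mon v \<delta> (shift a f) n" "min_mon v \<delta> (shift a g) m" using ex fg by blast
    then show ?thesis using omega_le_iff_min_mon fg gd_le_total' by blast
  qed
  show "omega_le v a \<delta> f h" if fgh: "f \<noteq> 0" "g \<noteq> 0" "h \<noteq> 0"
    and le: "omega_le v a \<delta> f g" "omega_le v a \<delta> g h"
  proof -
    obtain n where n: "min_mon v \<delta> (shift a f) n" using ex fgh by blast
    obtain m where m: "min_mon v \<delta> (shift a g) m" using ex fgh by blast
    obtain k where k: "min_mon v \<delta> (shift a h) k" using ex fgh by blast
    show ?thesis
      using le gd_le_trans[OF q]
      unfolding omega_le_iff_min_mon[OF fgh(1,2) n m] omega_le_iff_min_mon[OF fgh(2,3) m k]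
        omega_le_iff_min_mon[OF fgh(1,3) n k] by blast
  qed
  show "omega_le v a \<delta> f 0" by (simp add: omega_le_def)
  show "omega_le v a \<delta> f (- g)" if "f \<noteq> 0" "omega_le v a \<delta> f g"
    using that by (simp add: omega_le_def shift_minus)
  show "omega_le v a \<delta> f (g + h)" if "f \<noteq> 0" "omega_le v a \<delta> f g" "omega_le v a \<delta> f h"
    using that by (rule omega_le_add)
  show "omega_le v a \<delta> (f * h) (g * h) \<longleftrightarrow> omega_le v a \<delta> f g" if "f \<noteq> 0" "h \<noteq> 0"
    using that by (rule omega_le_cancel)
qed

lemma omega_ring_eq: "omega_ring v a \<delta> = valuation_preorder.ring_of (omega_le v a \<delta>)"
  by (simp add: omega_ring_def valuation_preorder.ring_of_def[OF omega_le_valuation_preorder])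

lemma Fract_in_omega_ring: "r \<noteq> 0 \<Longrightarrow> Fract p r \<in> omega_ring v a \<delta> \<longleftrightarrow> omega_le v a \<delta> r p"
  unfolding omega_ring_eq by (rule valuation_preorder.Fract_in_ring_of[OF omega_le_valuation_preorder])

lemma omega_ring_in_VV: "omega_ring v a \<delta> \<in> VV v"
proof -
  have "const_fr c \<in> omega_ring v a \<delta> \<longleftrightarrow> c = 0 \<or> 0 \<le> v c" for c
  proof -
    have "omega_le v a \<delta> [:1:] [:c:] \<longleftrightarrow> c = 0 \<or> 0 \<le> v c"
      unfolding omega_le_def shift_const
      by (auto simp: coeff_const_if gd_le_same)
    then show ?thesis using Fract_in_omega_ring[of 1 "[:c:]" a]
      by (simp add: const_fr_def one_pCons)
  qed
  then show ?thesis 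
    using valuation_preorder.ring_of_valuation_ring[OF omega_le_valuation_preorder]
    unfolding VV_def omega_ring_eq by simp
qed

text \<open>Around \<open>a\<close>, the polynomial \<open>x - b\<close> has coefficients
  \<open>a - b\<close> and 1, the former vanishing when \<open>b = a\<close>. Staying below a
  minimum means staying below both monomials.\<close>

lemma omega_le_const_linear:
  assumes "c \<noteq> 0"
  shows "omega_le v a \<delta> [:c:] [:- b, 1:] \<longleftrightarrow> v c \<in> fst \<delta> \<and> (b = a \<or> v c \<le> v (a - b))"
proof -
  have g: "gd_le \<delta> (0, v c) (Suc 0, 0) \<longleftrightarrow> v c \<in> fst \<delta>"
    using qcut_down[OF q] by (auto simp: gd_le_iff[OF q])
  have "omega_le v a \<delta> [:c:] [:- b, 1:] \<longleftrightarrow>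
     (\<forall>m. coeff [:a - b, 1:] m \<noteq> 0 \<longrightarrow> gd_le \<delta> (0, v c) (m, v (coeff [:a - b, 1:] m)))"
    unfolding omega_le_def shift_const shift_linear using assms
    by (auto simp: coeff_const_if coeff_linear_if)
  also have "\<dots> \<longleftrightarrow> (a - b \<noteq> 0 \<longrightarrow> gd_le \<delta> (0, v c) (0, v (a - b))) \<and> gd_le \<delta> (0, v c) (Suc 0, v 1)"
    by (auto simp: coeff_const_if coeff_linear_if)
  finally show ?thesis using g by (auto simp: gd_le_same)
qed

text \<open>Dually, lying above a minimum means lying above one of the two monomials.\<close>

lemma omega_le_linear_const:
  assumes "c \<noteq> 0"
  shows "omega_le v a \<delta> [:- b, 1:] [:c:] \<longleftrightarrow> v c \<in> snd \<delta> \<or> (b \<noteq> a \<and> v (a - b) \<le> v c)"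
proof -
  have g: "gd_le \<delta> (Suc 0, 0) (0, v c) \<longleftrightarrow> v c \<in> snd \<delta>"
    using qcut_up[OF q] by (auto simp: gd_le_iff[OF q])
  have "omega_le v a \<delta> [:- b, 1:] [:c:] \<longleftrightarrow>
     (\<exists>n. coeff [:a - b, 1:] n \<noteq> 0 \<and> gd_le \<delta> (n, v (coeff [:a - b, 1:] n)) (0, v c))"
    unfolding omega_le_def shift_const shift_linear using assms
    by (auto simp: coeff_const_if coeff_linear_if)
  also have "\<dots> \<longleftrightarrow> (a - b \<noteq> 0 \<and> gd_le \<delta> (0, v (a - b)) (0, v c)) \<or> gd_le \<delta> (Suc 0, v 1) (0, v c)"
    by (auto simp: coeff_const_if coeff_linear_if)
  finally show ?thesis using g by (auto simp: gd_le_same)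
qed

end

end

section \<open>Determination by linear polynomials\<close>

abbreviation lin :: "'a::field \<Rightarrow> 'a poly fract" where
  "lin b \<equiv> Fract [:- b, 1:] 1"

lemma const_fr_mult: "const_fr (c * d) = const_fr c * const_fr d"
  by (simp add: const_fr_def mult.commute)

lemma const_fr_power: "const_fr (c ^ n) = const_fr c ^ n"
  by (induction n) (simp_all add: const_fr_mult, simp add: const_fr_def One_fract_def one_pCons)

lemma const_fr_0 [simp]: "const_fr 0 = 0"
  by (simp add: const_fr_def fract_collapse)

lemma Fract_1_eq_0_iff: "Fract p 1 = 0 \<longleftrightarrow> p = 0"
  by (simp add: Zero_fract_def eq_fract)

lemma const_fr_eq_0_iff [simp]: "const_fr c = 0 \<longleftrightarrow> c = 0"
  by (simp add: const_fr_def Fract_1_eq_0_iff)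

lemma lin_nonzero [simp]: "lin b \<noteq> 0"
  by (simp add: Fract_1_eq_0_iff)

lemma lin_eq_add: "lin b = lin a + const_fr (a - b)"
  by (simp add: const_fr_def)

lemma lin_diff: "lin b - lin a = const_fr (a - b)"
  by (simp add: const_fr_def)

lemma vle_Fract: "p \<noteq> 0 \<Longrightarrow> vle R (Fract p 1) (Fract q 1) \<longleftrightarrow> Fract q p \<in> R"
  by (subst vle_iff_divide) (simp_all add: Fract_1_eq_0_iff)

context alg_closed_valued
begin

lemma VV_valuation_ring: "R \<in> VV v \<Longrightarrow> is_valuation_ring R"
  by (simp add: VV_def)

lemma vle_const:
  assumes "R \<in> VV v"
  shows "vle R (const_fr c) (const_fr d) \<longleftrightarrow> d = 0 \<or> (c \<noteq> 0 \<and> v c \<le> v d)"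
proof (cases "c = 0 \<or> d = 0")
  case True
  have "vle R 0 (const_fr d) \<longleftrightarrow> d = 0"
    using vle_0[OF VV_valuation_ring[OF assms], of 0] by (auto simp: vle_def)
  then show ?thesis using True vle_0[OF VV_valuation_ring[OF assms]] by auto
next
  case False
  have "vle R (const_fr c) (const_fr d) \<longleftrightarrow> Fract [:d:] [:c:] \<in> R"
    using False by (simp add: const_fr_def vle_Fract)
  also have "Fract [:d:] [:c:] = const_fr (d / c)"
    using False by (simp add: const_fr_def eq_fract)
  also have "const_fr (d / c) \<in> R \<longleftrightarrow> 0 \<le> v (d / c)"
    using assms False by (auto simp: VV_def set_eq_iff)
  finally show ?thesis using False by (simp add: v_divide)
qed

text \<open>This is the quasi-cut \<open>D(b)\<close>. Recording comparisons from both sides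
  distinguishes a value in \<Gamma>, which lands in both sets, from one outside.\<close>

definition lin_cut :: "'a poly fract set \<Rightarrow> 'a \<Rightarrow> 'g qcut" where
  "lin_cut R b = ({v c | c. c \<noteq> 0 \<and> vle R (const_fr c) (lin b)},
                  {v c | c. c \<noteq> 0 \<and> vle R (lin b) (const_fr c)})"

text \<open>Constants of equal value divide each other, so the test depends on \<open>v c\<close>
  only and not on the witness in the definition.\<close>

lemma lin_cut_lower:
  assumes "R \<in> VV v" "c \<noteq> 0"
  shows "v c \<in> fst (lin_cut R b) \<longleftrightarrow> vle R (const_fr c) (lin b)"
proof
  assume "v c \<in> fst (lin_cut R b)"
  then obtain d where d: "v c = v d" "d \<noteq> 0" "vle R (const_fr d) (lin b)" by (auto simp: lin_cut_def)
  then have "vle R (const_fr c) (const_fr d)" using vle_const assms by simp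
  then show "vle R (const_fr c) (lin b)" using d vle_trans VV_valuation_ring assms by blast
qed (use assms in \<open>auto simp: lin_cut_def\<close>)

lemma lin_cut_upper:
  assumes "R \<in> VV v" "c \<noteq> 0"
  shows "v c \<in> snd (lin_cut R b) \<longleftrightarrow> vle R (lin b) (const_fr c)"
proof
  assume "v c \<in> snd (lin_cut R b)"
  then obtain d where d: "v c = v d" "d \<noteq> 0" "vle R (lin b) (const_fr d)" by (auto simp: lin_cut_def)
  then have "vle R (const_fr d) (const_fr c)" using vle_const assms by simp
  then show "vle R (lin b) (const_fr c)" using d vle_trans VV_valuation_ring assms by blast
qed (use assms in \<open>auto simp: lin_cut_def\<close>)

lemma lin_cut_qcut:
  assumes "R \<in> VV v"
  shows "is_qcut (lin_cut R b)"
  unfolding is_qcut_def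
proof (intro conjI ballI)
  note R = VV_valuation_ring[OF assms]
  fix l r assume "l \<in> fst (lin_cut R b)" "r \<in> snd (lin_cut R b)"
  then obtain c d where "l = v c" "c \<noteq> 0" "vle R (const_fr c) (lin b)"
    "r = v d" "d \<noteq> 0" "vle R (lin b) (const_fr d)" by (auto simp: lin_cut_def)
  then show "l \<le> r" using vle_trans[OF R] vle_const[OF assms] by blast
next
  have "\<gamma> \<in> fst (lin_cut R b) \<or> \<gamma> \<in> snd (lin_cut R b)" for \<gamma>
  proof -
    obtain c where "c \<noteq> 0" "v c = \<gamma>" using onto by blast
    then show ?thesis
      using vle_total[OF VV_valuation_ring[OF assms]] lin_cut_lower lin_cut_upper assms by metis
  qed
  then show "fst (lin_cut R b) \<union> snd (lin_cut R b) = UNIV" by auto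
qed

lemma vle_monomial_iff:
  assumes R: "R \<in> VV v" and "c \<noteq> 0" "d \<noteq> 0"
  shows "vle R (const_fr c * lin a ^ k) (const_fr d * lin a ^ m) \<longleftrightarrow>
    (if k = m then v c \<le> v d
     else if k < m then \<exists>e. e \<noteq> 0 \<and> e ^ (m - k) = c / d \<and> v e \<in> fst (lin_cut R a)
     else \<exists>e. e \<noteq> 0 \<and> e ^ (k - m) = d / c \<and> v e \<in> snd (lin_cut R a))"
proof (cases k m rule: linorder_cases)
  case equal
  then show ?thesis using vle_cancel[OF VV_valuation_ring[OF R]] vle_const[OF R] assms by simp
next
  case less
  then obtain j where m: "m = k + j" "0 < j" by (metis less_imp_add_positive)
  have *: "vle R (const_fr c * lin a ^ k) (const_fr d * lin a ^ m) \<longleftrightarrow> vle R (const_fr e) (lin a)"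
    if e: "e ^ j = c / d" for e
  proof -
    have c: "const_fr c = const_fr e ^ j * const_fr d"
      using assms by (simp add: const_fr_mult[symmetric] const_fr_power[symmetric] e)
    have "vle R (const_fr c * lin a ^ k) (const_fr d * lin a ^ m) \<longleftrightarrow>
        vle R (const_fr e ^ j * (const_fr d * lin a ^ k)) (lin a ^ j * (const_fr d * lin a ^ k))"
      by (simp add: m c power_add mult_ac)
    also have "\<dots> \<longleftrightarrow> vle R (const_fr e) (lin a)"
      using assms(3) m(2) by (simp add: vle_cancel[OF VV_valuation_ring[OF R]] vle_power_iff[OF VV_valuation_ring[OF R]])
    finally show ?thesis .
  qed
  obtain e where e: "e ^ j = c / d" using root_exists[OF m(2)] by blast
  have nz: "e \<noteq> 0" if "e ^ j = c / d" for e
    using that assms(2,3) m(2) by (auto simp: power_0_left)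
  have "vle R (const_fr c * lin a ^ k) (const_fr d * lin a ^ m) \<longleftrightarrow>
      (\<exists>e. e \<noteq> 0 \<and> e ^ j = c / d \<and> v e \<in> fst (lin_cut R a))"
    using * e nz lin_cut_lower[OF R] by metis
  then show ?thesis using less m(1) by simp
next
  case greater
  then obtain j where k: "k = m + j" "0 < j" by (metis less_imp_add_positive)
  have *: "vle R (const_fr c * lin a ^ k) (const_fr d * lin a ^ m) \<longleftrightarrow> vle R (lin a) (const_fr e)"
    if e: "e ^ j = d / c" for e
  proof -
    have d: "const_fr d = const_fr e ^ j * const_fr c"
      using assms by (simp add: const_fr_mult[symmetric] const_fr_power[symmetric] e)
    have "vle R (const_fr c * lin a ^ k) (const_fr d * lin a ^ m) \<longleftrightarrow>
        vle R (lin a ^ j * (const_fr c * lin a ^ m)) (const_fr e ^ j * (const_fr c * lin a ^ m))"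
      by (simp add: k d power_add mult_ac)
    also have "\<dots> \<longleftrightarrow> vle R (lin a) (const_fr e)"
      using assms(2) k(2) by (simp add: vle_cancel[OF VV_valuation_ring[OF R]] vle_power_iff[OF VV_valuation_ring[OF R]])
    finally show ?thesis .
  qed
  obtain e where e: "e ^ j = d / c" using root_exists[OF k(2)] by blast
  have nz: "e \<noteq> 0" if "e ^ j = d / c" for e
    using that assms(2,3) k(2) by (auto simp: power_0_left)
  have "vle R (const_fr c * lin a ^ k) (const_fr d * lin a ^ m) \<longleftrightarrow>
      (\<exists>e. e \<noteq> 0 \<and> e ^ j = d / c \<and> v e \<in> snd (lin_cut R a))"
    using * e nz lin_cut_upper[OF R] by metis
  then show ?thesis using greater k(1) by simp
qed

definition veq :: "'a poly fract set \<Rightarrow> 'a poly fract \<Rightarrow> 'a poly fract \<Rightarrow> bool" where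
  "veq R x y \<longleftrightarrow> vle R x y \<and> vle R y x"

lemma vle_veq_cong:
  assumes "R \<in> VV v" "veq R x x'" "veq R y y'"
  shows "vle R x y \<longleftrightarrow> vle R x' y'"
proof -
  note t = vle_trans[OF VV_valuation_ring[OF assms(1)]]
  show ?thesis
  proof
    assume "vle R x y"
    then have "vle R x' y" using assms(2) t by (auto simp: veq_def)
    then show "vle R x' y'" using assms(3) t by (auto simp: veq_def)
  next
    assume "vle R x' y'"
    then have "vle R x y'" using assms(2) t by (auto simp: veq_def)
    then show "vle R x y" using assms(3) t by (auto simp: veq_def)
  qed
qed

text \<open>If some \<open>x - a\<close> has value outside \<open>\<Gamma>\<close>, then every \<open>x - b\<close> is equivalent to \<open>x - a\<close> or to the
  constant \<open>a - b\<close>; otherwise every \<open>x - b\<close> is equivalent to a constant.\<close>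

lemma lin_veq_monomial:
  "\<exists>a. \<forall>b. \<exists>c k. c \<noteq> 0 \<and> (\<forall>R\<in>VV v. lin_cut R = D \<longrightarrow> veq R (lin b) (const_fr c * lin a ^ k))"
proof (cases "\<exists>a. fst (D a) \<inter> snd (D a) = {}")
  case True
  then obtain a where a: "fst (D a) \<inter> snd (D a) = {}" by blast
  have "\<exists>c k. c \<noteq> 0 \<and> (\<forall>R\<in>VV v. lin_cut R = D \<longrightarrow> veq R (lin b) (const_fr c * lin a ^ k))" for b
  proof (cases "a = b")
    case True
    have "veq R (lin b) (const_fr 1 * lin a ^ 1)" if "R \<in> VV v" for R
      using True vle_refl[OF VV_valuation_ring[OF that]]
      by (simp add: veq_def const_fr_def fract_collapse one_pCons[symmetric])
    then show ?thesis by (metis zero_neq_one)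
  next
    case ab: False
    show ?thesis
    proof (cases "v (a - b) \<in> fst (D a)")
      case True
      have "veq R (lin b) (const_fr (a - b) * lin a ^ 0)" if R: "R \<in> VV v" "lin_cut R = D" for R
      proof -
        have "\<not> vle R (lin a) (const_fr (a - b))" using True a R lin_cut_upper[of R "a - b" a] ab by auto
        then show ?thesis
          using vle_add_dominated[OF VV_valuation_ring[OF R(1)], of "lin a" "const_fr (a - b)"]
          unfolding veq_def lin_eq_add[of b a] by (simp add: add.commute)
      qed
      then show ?thesis using ab by (metis right_minus_eq)
    next
      case False
      have "veq R (lin b) (const_fr 1 * lin a ^ 1)" if R: "R \<in> VV v" "lin_cut R = D" for R
      proof -
        have "\<not> vle R (const_fr (a - b)) (lin a)" using False R lin_cut_lower[of R "a - b" a] ab by auto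
        moreover have "const_fr 1 * lin a ^ 1 = lin a"
          by (simp add: const_fr_def fract_collapse one_pCons[symmetric])
        ultimately show ?thesis
          using vle_add_dominated[OF VV_valuation_ring[OF R(1)], of "const_fr (a - b)" "lin a"]
          unfolding veq_def lin_eq_add[of b a] by simp
      qed
      then show ?thesis by (metis zero_neq_one)
    qed
  qed
  then show ?thesis by blast
next
  case False
  have "\<exists>c k. c \<noteq> 0 \<and> (\<forall>R\<in>VV v. lin_cut R = D \<longrightarrow> veq R (lin b) (const_fr c * lin 0 ^ k))" for b
  proof -
    obtain \<gamma> where "\<gamma> \<in> fst (D b)" "\<gamma> \<in> snd (D b)" using False by blast
    then obtain c where c: "c \<noteq> 0" "v c \<in> fst (D b)" "v c \<in> snd (D b)" using onto by metis
    have "veq R (lin b) (const_fr c * lin 0 ^ 0)" if R: "R \<in> VV v" "lin_cut R = D" for R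
      using c R lin_cut_lower lin_cut_upper by (auto simp: veq_def)
    then show ?thesis using c by blast
  qed
  then show ?thesis by blast
qed

text \<open>The monomials of the linear factors multiply. They are chosen from \<open>D\<close>
  before any ring is fixed, so rings with the same cuts share the same monomial for each
  \<open>f\<close>.\<close>

lemma poly_veq_monomial:
  "\<exists>a. \<forall>f. f \<noteq> 0 \<longrightarrow> (\<exists>c k. c \<noteq> 0 \<and> (\<forall>R\<in>VV v. lin_cut R = D \<longrightarrow> veq R (Fract f 1) (const_fr c * lin a ^ k)))"
proof -
  obtain a where a: "\<And>b. \<exists>c k. c \<noteq> 0 \<and> (\<forall>R\<in>VV v. lin_cut R = D \<longrightarrow> veq R (lin b) (const_fr c * lin a ^ k))"
    using lin_veq_monomial by blast
  have "\<exists>c k. c \<noteq> 0 \<and> (\<forall>R\<in>VV v. lin_cut R = D \<longrightarrow> veq R (Fract f 1) (const_fr c * lin a ^ k))" if "f \<noteq> 0" for f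
    using that
  proof (induction rule: poly_factor_induct)
    case (const c)
    have "veq R (Fract [:c:] 1) (const_fr c * lin a ^ 0)" if "R \<in> VV v" for R
      using vle_refl[OF VV_valuation_ring[OF that]] by (simp add: veq_def const_fr_def)
    then show ?case using const by blast
  next
    case (linear b f)
    obtain c k where 1: "c \<noteq> 0" "\<forall>R\<in>VV v. lin_cut R = D \<longrightarrow> veq R (Fract f 1) (const_fr c * lin a ^ k)"
      using linear by blast
    obtain d j where 2: "d \<noteq> 0" "\<forall>R\<in>VV v. lin_cut R = D \<longrightarrow> veq R (lin b) (const_fr d * lin a ^ j)"
      using a by blast
    have "veq R (Fract ([:- b, 1:] * f) 1) (const_fr (d * c) * lin a ^ (j + k))"
      if R: "R \<in> VV v" "lin_cut R = D" for R
    proof -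
      have "Fract ([:- b, 1:] * f) 1 = lin b * Fract f 1"
        by (simp only: mult_fract mult_1_right)
      moreover have "const_fr (d * c) * lin a ^ (j + k) = (const_fr d * lin a ^ j) * (const_fr c * lin a ^ k)"
        by (simp add: const_fr_mult power_add mult_ac)
      ultimately show ?thesis
        using 1(2) 2(2) R vle_mult[OF VV_valuation_ring[OF R(1)]] unfolding veq_def by metis
    qed
    then show ?case using 1(1) 2(1) by (metis mult_eq_0_iff)
  qed
  then show ?thesis by blast
qed

text \<open>Both rings see numerator and denominator as the same monomials, and comparison of
  monomials is decided by the common cut of \<open>x - a\<close>.\<close>

lemma VV_eqI:
  assumes R: "R1 \<in> VV v" "R2 \<in> VV v" and eq: "\<And>b. lin_cut R1 b = lin_cut R2 b"
  shows "R1 = R2"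
proof -
  let ?D = "lin_cut R1"
  obtain a where a: "\<And>f. f \<noteq> 0 \<Longrightarrow>
      \<exists>c k. c \<noteq> 0 \<and> (\<forall>R\<in>VV v. lin_cut R = ?D \<longrightarrow> veq R (Fract f 1) (const_fr c * lin a ^ k))"
    using poly_veq_monomial[of ?D] by blast
  have eq': "lin_cut R2 = ?D" using eq by auto
  have "Fract p q \<in> R1 \<longleftrightarrow> Fract p q \<in> R2" if "q \<noteq> 0" for p q
  proof (cases "p = 0")
    case True
    then show ?thesis using R by (simp add: fract_collapse VV_def is_valuation_ring_def)
  next
    case False
    obtain c k where 1: "c \<noteq> 0" "\<forall>R\<in>VV v. lin_cut R = ?D \<longrightarrow> veq R (Fract q 1) (const_fr c * lin a ^ k)"
      using a \<open>q \<noteq> 0\<close> by blast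
    obtain d m where 2: "d \<noteq> 0" "\<forall>R\<in>VV v. lin_cut R = ?D \<longrightarrow> veq R (Fract p 1) (const_fr d * lin a ^ m)"
      using a False by blast
    have *: "Fract p q \<in> R \<longleftrightarrow> vle R (const_fr c * lin a ^ k) (const_fr d * lin a ^ m)"
      if "R \<in> VV v" "lin_cut R = ?D" for R
      unfolding vle_Fract[OF \<open>q \<noteq> 0\<close>, symmetric]
      by (rule vle_veq_cong[OF that(1)]) (use 1(2) 2(2) that in auto)
    show ?thesis
      using *[OF R(1) refl] *[OF R(2) eq'] eq
      by (simp add: vle_monomial_iff[OF R(1) 1(1) 2(1)] vle_monomial_iff[OF R(2) 1(1) 2(1)])
  qed
  then show ?thesis by (metis Fract_cases subsetI subset_antisym)
qed

text \<open>Applied to \<open>x - b\<close>, the order supplies a constant between the two values;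
  its own value separates the two quasi-cuts.\<close>

lemma VV_le_imp_lin_cut_le:
  assumes R: "R1 \<in> VV v" "R2 \<in> VV v" and le: "VV_le R1 R2"
  shows "qc_le (lin_cut R1 b) (lin_cut R2 b)"
proof (cases "R1 = R2")
  case True
  then show ?thesis by (simp add: qc_le_def)
next
  case False
  then have "\<forall>f :: 'a poly. f \<noteq> 0 \<longrightarrow> (\<exists>c. c \<noteq> 0 \<and> Fract [:c:] f \<in> R1 \<and> Fract f [:c:] \<in> R2)"
    using le by (simp add: VV_le_def)
  from this[rule_format, of "[:- b, 1:]"]
  obtain c where c: "c \<noteq> 0" "Fract [:c:] [:- b, 1:] \<in> R1" "Fract [:- b, 1:] [:c:] \<in> R2"
    by auto
  then have mem: "v c \<in> snd (lin_cut R1 b)" "v c \<in> fst (lin_cut R2 b)"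
    using R by (simp_all add: lin_cut_upper lin_cut_lower const_fr_def vle_Fract)
  note q = lin_cut_qcut[OF R(1), of b] lin_cut_qcut[OF R(2), of b]
  have "l \<le> v c" if "l \<in> fst (lin_cut R1 b)" for l using q(1) mem(1) that by (auto simp: is_qcut_def)
  moreover have "v c \<le> r" if "r \<in> snd (lin_cut R2 b)" for r using q(2) mem(2) that by (auto simp: is_qcut_def)
  ultimately show ?thesis
    using qcut_up[OF q(1) mem(1)] qcut_down[OF q(2) mem(2)] by (auto simp: qc_le_def)
qed

text \<open>Constants separating the values of the linear factors multiply to a constant separating
  the values of the product.\<close>

lemma VV_leI:
  assumes R: "R1 \<in> VV v" "R2 \<in> VV v"
    and mid: "\<And>b. \<exists>\<gamma>. \<gamma> \<in> snd (lin_cut R1 b) \<and> \<gamma> \<in> fst (lin_cut R2 b)"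
  shows "VV_le R1 R2"
proof -
  have "\<exists>c. c \<noteq> 0 \<and> vle R1 (Fract f 1) (const_fr c) \<and> vle R2 (const_fr c) (Fract f 1)" if "f \<noteq> 0" for f
    using that
  proof (induction rule: poly_factor_induct)
    case (const c)
    then show ?case using vle_refl[OF VV_valuation_ring[OF R(1)]] vle_refl[OF VV_valuation_ring[OF R(2)]]
      unfolding const_fr_def by blast
  next
    case (linear b f)
    obtain c where c: "c \<noteq> 0" "vle R1 (Fract f 1) (const_fr c)" "vle R2 (const_fr c) (Fract f 1)"
      using linear by blast
    obtain \<gamma> where "\<gamma> \<in> snd (lin_cut R1 b)" "\<gamma> \<in> fst (lin_cut R2 b)" using mid by blast
    moreover obtain d where "d \<noteq> 0" "v d = \<gamma>" using onto by blast
    ultimately have d: "d \<noteq> 0" "vle R1 (lin b) (const_fr d)" "vle R2 (const_fr d) (lin b)"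
      using lin_cut_lower R lin_cut_upper by auto
    have "Fract ([:- b, 1:] * f) 1 = lin b * Fract f 1"
      by (simp only: mult_fract mult_1_right)
    then show ?case
      using vle_mult[OF VV_valuation_ring[OF R(1)] d(2) c(2)] vle_mult[OF VV_valuation_ring[OF R(2)] d(3) c(3)]
        c(1) d(1) by (metis const_fr_mult mult_eq_0_iff)
  qed
  moreover have "vle R1 (Fract f 1) (const_fr c) \<longleftrightarrow> Fract [:c:] f \<in> R1"
    "vle R2 (const_fr c) (Fract f 1) \<longleftrightarrow> Fract f [:c:] \<in> R2" if "f \<noteq> 0" "c \<noteq> 0" for f c
    using that by (simp_all add: const_fr_def vle_Fract)
  ultimately show ?thesis unfolding VV_le_def by blast
qed

text \<open>Taking the minimum of \<open>v (a - b)\<close> and \<open>\<delta>\<close> intersects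
  left sides and unites right sides; for \<open>b = a\<close> only \<open>\<delta>\<close>
  remains.\<close>

lemma lin_cut_omega_ring:
  assumes q: "is_qcut \<delta>"
  shows "lin_cut (omega_ring v a \<delta>) b =
    ({\<gamma> \<in> fst \<delta>. b = a \<or> \<gamma> \<le> v (a - b)}, {\<gamma>. \<gamma> \<in> snd \<delta> \<or> (b \<noteq> a \<and> v (a - b) \<le> \<gamma>)})"
proof -
  note V = omega_ring_in_VV[OF q, of a]
  have "v c \<in> fst (lin_cut (omega_ring v a \<delta>) b) \<longleftrightarrow> v c \<in> fst \<delta> \<and> (b = a \<or> v c \<le> v (a - b))"
    if "c \<noteq> 0" for c
    using that by (simp add: lin_cut_lower[OF V] const_fr_def vle_Fract Fract_in_omega_ring[OF q]
      omega_le_const_linear[OF q])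
  moreover have "v c \<in> snd (lin_cut (omega_ring v a \<delta>) b) \<longleftrightarrow> v c \<in> snd \<delta> \<or> (b \<noteq> a \<and> v (a - b) \<le> v c)"
    if "c \<noteq> 0" for c
    using that by (simp add: lin_cut_upper[OF V] const_fr_def vle_Fract Fract_in_omega_ring[OF q]
      omega_le_linear_const[OF q])
  ultimately show ?thesis using onto by (auto simp: prod_eq_iff set_eq_iff) metis+
qed

text \<open>For a cut, exceeding the whole left side is lying in the right side; for a radius in
  \<Gamma> the right side is the ray from the radius. One description thus serves both kinds of
  ball.\<close>

lemma mem_ball_v:
  assumes q: "is_qcut \<delta>"
  shows "c \<in> ball_v v a \<delta> \<longleftrightarrow> c = a \<or> v (c - a) \<in> snd \<delta>"
proof (cases "is_cut \<delta>")
  case True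
  have "(\<forall>l\<in>fst \<delta>. l < \<gamma>) \<longleftrightarrow> \<gamma> \<in> snd \<delta>" for \<gamma>
    using True unfolding is_cut_def is_qcut_def
    by (metis UNIV_I UnE disjoint_iff less_irrefl order_le_imp_less_or_eq)
  then show ?thesis using True by (simp add: ball_v_def)
next
  case False
  then obtain \<gamma> where "\<delta> = qc_of \<gamma>" "qc_rad \<delta> = \<gamma>" using qcut_not_cutE[OF q] by blast
  then show ?thesis using False by (simp add: ball_v_def cball_v_def) (simp add: qc_of_def)
qed

lemma omega_ring_recenter:
  assumes q: "is_qcut \<delta>" and a': "a' \<in> ball_v v a \<delta>"
  shows "omega_ring v a' \<delta> = omega_ring v a \<delta>"
proof (cases "a' = a")
  case False
  then have m: "v (a' - a) \<in> snd \<delta>" using a' mem_ball_v[OF q] by blast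
  have le: "l \<le> v (a' - a)" if "l \<in> fst \<delta>" for l using q m that by (auto simp: is_qcut_def)
  \<comment> \<open>This fact and the next are stated for arbitrary centres, so that they can be
    used with \<open>a\<close> and \<open>a'\<close> exchanged.\<close>
  have 1: "b = a' \<or> \<gamma> \<le> v (a' - b)" if "\<gamma> \<in> fst \<delta>" "b = a \<or> \<gamma> \<le> v (a - b)" "\<gamma> \<le> v (a' - a)" for a a' b \<gamma>
    using v_add_ge[of "a' - a" \<gamma> "a - b"] that by auto
  have 2: "\<gamma> \<in> snd \<delta> \<or> b \<noteq> a' \<and> v (a' - b) \<le> \<gamma>"
    if "b \<noteq> a" "v (a - b) \<le> \<gamma>" "\<And>l. l \<in> fst \<delta> \<Longrightarrow> l \<le> v (a' - a)" "v (a' - a) \<in> snd \<delta>" for a a' b \<gamma>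
  \<comment> \<open>Either \<open>v (a' - a)\<close> lies below \<open>\<gamma>\<close> and
    membership in the right side passes upwards, or \<open>a - b\<close> dominates and
    \<open>v (a' - b) = v (a - b)\<close>.\<close>
  proof (cases "v (a' - a) \<le> v (a - b)")
    case True
    then show ?thesis using qcut_up[OF q] that by (metis order_trans)
  next
    case False
    then have "v (a - b) < v (a' - a)" by simp
    then show ?thesis using v_add_eq[of "a - b" "a' - a"] that(1,2) by auto
  qed
  show ?thesis
  proof (rule VV_eqI[OF omega_ring_in_VV[OF q] omega_ring_in_VV[OF q]])
    fix b
    show "lin_cut (omega_ring v a' \<delta>) b = lin_cut (omega_ring v a \<delta>) b"
      unfolding lin_cut_omega_ring[OF q]
      using 1[of _ b a a'] 1[of _ b a' a] 2[of b a _ a'] 2[of b a' _ a] le m v_minus_commute[of a a']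
      by auto
  qed
qed simp

end

context alg_closed_valued
begin

section \<open>Nests of closed balls\<close>

lemma center_in_cball: "a \<in> cball_v v a \<gamma>"
  by (simp add: cball_v_def)

lemma gd_le_qc_of: "gd_le (qc_of \<gamma>) (n, e) (m, e') \<longleftrightarrow> gsmul n \<gamma> + e \<le> gsmul m \<gamma> + e'"
proof -
  have nc: "\<not> is_cut (qc_of \<gamma>)" by (auto simp: is_cut_def qc_of_def)
  have "qc_rad (qc_of \<gamma>) = \<gamma>"
    unfolding qc_rad_def by (rule the_equality) (auto simp: qc_of_def)
  then show ?thesis using nc by (simp add: gd_le_def)
qed

lemma omega_cl_min_mon:
  assumes "min_mon v (qc_of \<gamma>) (shift a f) n"
  shows "omega_cl v a \<gamma> f = v (coeff (shift a f) n) + gsmul n \<gamma>"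
  unfolding omega_cl_def
proof (rule Min_eqI)
  have "finite {n. coeff (shift a f) n \<noteq> 0}"
    by (rule finite_subset[of _ "{..degree (shift a f)}"]) (auto simp: le_degree)
  then show "finite {v (coeff (shift a f) n) + gsmul n \<gamma> | n. coeff (shift a f) n \<noteq> 0}"
    by (simp add: setcompr_eq_image)
qed (use assms in \<open>auto simp: min_mon_def gd_le_qc_of add.commute\<close>)

lemma omega_cl_mult:
  assumes "f \<noteq> 0" "g \<noteq> 0"
  shows "omega_cl v a \<gamma> (f * g) = omega_cl v a \<gamma> f + omega_cl v a \<gamma> g"
proof -
  let ?L = "\<lambda>f. LEAST n. min_mon v (qc_of \<gamma>) (shift a f) n"
  have L: "min_mon v (qc_of \<gamma>) (shift a f) (?L f)" if "f \<noteq> 0" for f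
    by (rule LeastI_ex[OF min_mon_exists[OF is_qcut_qc_of]]) (use that in simp)
  have M: "min_mon v (qc_of \<gamma>) (shift a (f * g)) (?L f + ?L g)"
    "v (coeff (shift a (f * g)) (?L f + ?L g)) = v (coeff (shift a f) (?L f)) + v (coeff (shift a g) (?L g))"
    using min_mon_mult[OF is_qcut_qc_of, of "shift a f" "shift a g"] assms by (simp_all add: shift_mult)
  show ?thesis
    unfolding omega_cl_min_mon[OF M(1)] omega_cl_min_mon[OF L[OF assms(1)]] omega_cl_min_mon[OF L[OF assms(2)]] M(2)
    by (simp add: gsmul_add add_ac)
qed

lemma omega_cl_const:
  assumes "c \<noteq> 0"
  shows "omega_cl v a \<gamma> [:c:] = v c"
proof -
  have "{v (coeff [:c:] n) + gsmul n \<gamma> | n. coeff [:c:] n \<noteq> 0} = {v c}"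
    using assms by (auto simp: coeff_const_if)
  then show ?thesis by (simp add: omega_cl_def)
qed

lemma omega_cl_linear: "omega_cl v a \<gamma> [:- b, 1:] = (if a = b then \<gamma> else min (v (a - b)) \<gamma>)"
proof -
  have "{v (coeff [:a - b, 1:] n) + gsmul n \<gamma> | n. coeff [:a - b, 1:] n \<noteq> 0}
      = (if a = b then {\<gamma>} else {v (a - b), \<gamma>})"
    by (auto simp: coeff_linear_if)
  then show ?thesis by (simp add: omega_cl_def)
qed

text \<open>Points of the ball are closer to \<open>a\<close> than \<open>b\<close> is, so the
  ultrametric inequality makes them all equidistant from \<open>b\<close>.\<close>

lemma v_diff_outside_cball:
  assumes "b \<notin> cball_v v a \<gamma>" "z \<in> cball_v v a \<gamma>"
  shows "z - b \<noteq> 0" "v (z - b) = v (a - b)" "v (a - b) < \<gamma>" "a \<noteq> b"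
proof -
  show ab: "a \<noteq> b" and lt: "v (a - b) < \<gamma>"
    using assms(1) v_minus_commute[of a b] by (auto simp: cball_v_def)
  have "z - a = 0 \<or> v (a - b) < v (z - a)" using assms(2) lt by (auto simp: cball_v_def)
  then show "z - b \<noteq> 0" "v (z - b) = v (a - b)" using v_add_eq[of "a - b" "z - a"] ab by auto
qed

text \<open>Every linear factor has its root \<open>b\<close> outside the ball, and there
  \<open>v (z - b)\<close> is the minimum defining the value of that factor.\<close>

lemma omega_cl_no_root:
  assumes "f \<noteq> 0" "z \<in> cball_v v a \<gamma>" "\<And>b. b \<in> cball_v v a \<gamma> \<Longrightarrow> poly f b \<noteq> 0"
  shows "omega_cl v a \<gamma> f = v (poly f z)"
  using assms(1,3)
proof (induction rule: poly_factor_induct)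
  case (const c)
  then show ?case by (simp add: omega_cl_const)
next
  case (linear b f)
  have b: "b \<notin> cball_v v a \<gamma>" using linear.prems[of b] by auto
  have f: "\<And>c. c \<in> cball_v v a \<gamma> \<Longrightarrow> poly f c \<noteq> 0" using linear.prems by auto
  have "omega_cl v a \<gamma> [:- b, 1:] = v (z - b)"
    using v_diff_outside_cball[OF b assms(2)] by (simp add: omega_cl_linear)
  moreover have "v (poly ([:- b, 1:] * f) z) = v (z - b) + v (poly f z)"
    using v_mult[OF v_diff_outside_cball(1)[OF b assms(2)] f[OF assms(2)]]
    unfolding poly_mult by simp
  ultimately show ?case using linear.IH[OF f] linear.hyps by (simp add: omega_cl_mult del: mult_pCons_left)
qed

text \<open>Multiplicativity reduces this to linear factors, where a smaller ball means a larger
  radius and a centre within the larger ball.\<close>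

lemma omega_cl_antimono:
  assumes "f \<noteq> 0" and sub: "cball_v v b \<beta> \<subseteq> cball_v v a \<alpha>"
  shows "omega_cl v a \<alpha> f \<le> omega_cl v b \<beta> f"
proof -
  have ba: "b = a \<or> \<alpha> \<le> v (b - a)" using sub center_in_cball[of b \<beta>] by (auto simp: cball_v_def)
  \<comment> \<open>Surjectivity of \<open>v\<close> gives a point of the smaller ball at value
    exactly \<open>\<beta>\<close> from its centre, so inclusion of balls does compare
    radii.\<close>
  have "\<alpha> \<le> \<beta>"
  proof -
    obtain e where e: "e \<noteq> 0" "v e = \<beta>" using onto by blast
    have "b + e \<in> cball_v v b \<beta>" using e by (simp add: cball_v_def)
    then have "b + e \<in> cball_v v a \<alpha>" using sub by blast
    then have "(b + e) - a = 0 \<or> \<alpha> \<le> v ((b + e) - a)" by (auto simp: cball_v_def)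
    then have "e = 0 \<or> \<alpha> \<le> v e" using v_diff_ge[of "(b + e) - a" \<alpha> "b - a"] ba by simp
    then show ?thesis using e by simp
  qed
  show ?thesis using assms(1)
  proof (induction rule: poly_factor_induct)
    case (const c)
    then show ?case by (simp add: omega_cl_const)
  next
    case (linear c f)
    have "omega_cl v a \<alpha> [:- c, 1:] \<le> omega_cl v b \<beta> [:- c, 1:]"
    proof (cases "a = c")
      case True
      then show ?thesis using ba \<open>\<alpha> \<le> \<beta>\<close> by (auto simp: omega_cl_linear)
    next
      case False
      let ?m = "min (v (a - c)) \<alpha>"
      have "(b - a) + (a - c) = 0 \<or> ?m \<le> v ((b - a) + (a - c))"
        by (rule v_add_ge) (use ba in \<open>auto simp: min_le_iff_disj\<close>)
      then show ?thesis using False \<open>\<alpha> \<le> \<beta>\<close> by (auto simp: omega_cl_linear min_le_iff_disj)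
    qed
    then show ?case using linear by (simp add: omega_cl_mult add_mono del: mult_pCons_left)
  qed
qed

text \<open>Two presentations of one ball are included in each other, so monotonicity both ways
  removes the dependence on centre and radius.\<close>

lemma omega_ball_cball:
  assumes "f \<noteq> 0"
  shows "omega_ball v (cball_v v a \<gamma>) f = omega_cl v a \<gamma> f"
  unfolding omega_ball_def
proof (rule the_equality)
  show "\<exists>b \<beta>. cball_v v a \<gamma> = cball_v v b \<beta> \<and> omega_cl v a \<gamma> f = omega_cl v b \<beta> f" by blast
  fix w assume "\<exists>b \<beta>. cball_v v a \<gamma> = cball_v v b \<beta> \<and> w = omega_cl v b \<beta> f"
  then show "w = omega_cl v a \<gamma> f"
    using omega_cl_antimono[OF assms] by (metis order.antisym order.refl)
qed

section \<open>The valuation attached to a nest\<close>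

context
  fixes N
  assumes N: "is_nest v N"
begin

lemma nest_cball: "B \<in> N \<Longrightarrow> \<exists>a \<gamma>. B = cball_v v a \<gamma>"
  using N by (auto simp: is_nest_def)

lemma nest_nonempty: "B \<in> N \<Longrightarrow> \<exists>z. z \<in> B"
  using nest_cball center_in_cball by blast

lemma nest_chain: "B \<in> N \<Longrightarrow> B' \<in> N \<Longrightarrow> B \<subseteq> B' \<or> B' \<subseteq> B"
  using N by (auto simp: is_nest_def)

lemma nest_avoid: "\<exists>B\<in>N. b \<notin> B"
  using N by (auto simp: is_nest_def)

lemma nest_avoid_finite:
  assumes "finite S" "B0 \<in> N"
  shows "\<exists>B\<in>N. B \<subseteq> B0 \<and> B \<inter> S = {}"
  using assms(1)
proof (induction rule: finite_induct)
  case empty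
  then show ?case using assms(2) by blast
next
  case (insert x F)
  then obtain B where B: "B \<in> N" "B \<subseteq> B0" "B \<inter> F = {}" by blast
  obtain B' where B': "B' \<in> N" "x \<notin> B'" using nest_avoid by blast
  show ?case using nest_chain[OF B(1) B'(1)]
  proof
    assume "B \<subseteq> B'"
    then show ?thesis using B B' by (intro bexI[of _ B]) auto
  next
    assume "B' \<subseteq> B"
    then show ?thesis using B B' by (intro bexI[of _ B']) auto
  qed
qed

text \<open>On \<open>B\<close> the value of \<open>f\<close> is constant and equal to the value
  attached to \<open>B\<close>. Larger balls give at most this and smaller ones exactly this, so the
  maximum over the nest exists and is attained at \<open>B\<close>.\<close>

lemma omega_nest_eq:
  assumes "f \<noteq> 0" "B \<in> N" "\<And>b. b \<in> B \<Longrightarrow> poly f b \<noteq> 0" "z \<in> B"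
  shows "omega_nest v N f = v (poly f z)"
  unfolding omega_nest_def
proof (rule Greatest_equality)
  have B: "omega_ball v B f = v (poly f y)" if "y \<in> B" for y
  proof -
    obtain a \<gamma> where "B = cball_v v a \<gamma>" using nest_cball assms(2) by blast
    then show ?thesis using omega_ball_cball omega_cl_no_root assms that by metis
  qed
  then show "v (poly f z) \<in> (\<lambda>B. omega_ball v B f) ` N" using assms by (metis imageI)
  fix w assume "w \<in> (\<lambda>B. omega_ball v B f) ` N"
  then obtain B' where B': "B' \<in> N" "w = omega_ball v B' f" by blast
  obtain a \<gamma> where a: "B' = cball_v v a \<gamma>" using nest_cball B' by blast
  obtain a' \<gamma>' where a': "B = cball_v v a' \<gamma>'" using nest_cball assms(2) by blast
  show "w \<le> v (poly f z)"
    using nest_chain[OF assms(2) B'(1)]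
  proof
    assume "B \<subseteq> B'"
    then show ?thesis
      using omega_cl_antimono[OF assms(1), of a' \<gamma>' a \<gamma>] B[OF assms(4)] B'(2) omega_ball_cball[OF assms(1)] a a'
      by simp
  next
    assume sub: "B' \<subseteq> B"
    have "omega_ball v B' f = v (poly f a)"
      unfolding a omega_ball_cball[OF assms(1)]
      by (rule omega_cl_no_root[OF assms(1) center_in_cball]) (use sub assms(3) a in blast)
    moreover have "v (poly f a) = v (poly f z)"
      using B[of a] B[OF assms(4)] sub center_in_cball[of a \<gamma>] unfolding a by auto
    ultimately show ?thesis using B'(2) by simp
  qed
qed

text \<open>A ball avoiding all roots of finitely many polynomials gives one evaluation point for
  all of them, so the laws of \<open>v\<close> carry over to \<open>omega_nest\<close>.\<close>

lemma nest_point: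
  assumes "finite F" "0 \<notin> F"
  shows "\<exists>z. \<forall>f\<in>F. poly f z \<noteq> 0 \<and> omega_nest v N f = v (poly f z)"
proof -
  have "finite (\<Union>f\<in>F. {z. poly f z = 0})" using assms by (auto intro!: poly_roots_finite)
  moreover obtain B0 where "B0 \<in> N" using nest_avoid by blast
  ultimately obtain B where B: "B \<in> N" "B \<inter> (\<Union>f\<in>F. {z. poly f z = 0}) = {}"
    using nest_avoid_finite by metis
  obtain z where z: "z \<in> B" using nest_nonempty[OF B(1)] by blast
  have "poly f z \<noteq> 0 \<and> omega_nest v N f = v (poly f z)" if "f \<in> F" for f
  proof -
    have nr: "poly f b \<noteq> 0" if "b \<in> B" for b using B(2) \<open>f \<in> F\<close> that by auto
    have "f \<noteq> 0" using assms(2) that by auto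
    then show ?thesis using omega_nest_eq[OF _ B(1) nr z] nr[OF z] by simp
  qed
  then show ?thesis by blast
qed

lemma nest_valuation_preorder: "valuation_preorder (\<lambda>q p. p = 0 \<or> omega_nest v N q \<le> omega_nest v N p)"
  (is "valuation_preorder ?W")
proof
  fix f g h :: "'a poly"
  show "?W f g \<or> ?W g f" by auto
  show "?W f h" if "h \<noteq> 0" "g \<noteq> 0" "?W f g" "?W g h" using that by auto
  show "?W f 0" by simp
  \<comment> \<open>\<open>omega_nest\<close> is meaningless at zero, so vanishing polynomials are
    split off before an evaluation point is chosen.\<close>
  show "?W f (- g)" if "f \<noteq> 0" "?W f g"
  proof (cases "g = 0")
    case False
    then show ?thesis using nest_point[of "{f, g, - g}"] that by auto
  qed simp
  show "?W f (g + h)" if "f \<noteq> 0" "?W f g" "?W f h"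
  proof (cases "g = 0 \<or> h = 0 \<or> g + h = 0")
    case False
    then have "0 \<notin> {f, g, h, g + h}" using that by auto
    then obtain z where "\<forall>f\<in>{f, g, h, g + h}. poly f z \<noteq> 0 \<and> omega_nest v N f = v (poly f z)"
      using nest_point[of "{f, g, h, g + h}"] by blast
    then show ?thesis using v_add_ge[of "poly g z" "v (poly f z)" "poly h z"] that False by simp
  qed (use that in auto)
  show "?W (f * h) (g * h) \<longleftrightarrow> ?W f g" if "f \<noteq> 0" "h \<noteq> 0"
  proof (cases "g = 0")
    case False
    then have "0 \<notin> {f, g, h, f * h, g * h}" using that by auto
    then obtain z where "\<forall>f\<in>{f, g, h, f * h, g * h}. poly f z \<noteq> 0 \<and> omega_nest v N f = v (poly f z)"
      using nest_point[of "{f, g, h, f * h, g * h}"] by blast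
    then show ?thesis using False that by (simp add: v_mult)
  qed simp
qed

lemma nest_ring_eq:
  "nest_ring v N = valuation_preorder.ring_of (\<lambda>q p. p = 0 \<or> omega_nest v N q \<le> omega_nest v N p)"
  by (simp add: nest_ring_def valuation_preorder.ring_of_def[OF nest_valuation_preorder])

lemma Fract_in_nest_ring:
  "q \<noteq> 0 \<Longrightarrow> Fract p q \<in> nest_ring v N \<longleftrightarrow> p = 0 \<or> omega_nest v N q \<le> omega_nest v N p"
  unfolding nest_ring_eq by (rule valuation_preorder.Fract_in_ring_of[OF nest_valuation_preorder])

lemma omega_nest_const: "c \<noteq> 0 \<Longrightarrow> omega_nest v N [:c:] = v c"
  using nest_point[of "{[:c:]}"] by auto

lemma nest_ring_in_VV: "nest_ring v N \<in> VV v"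
proof -
  have "const_fr c \<in> nest_ring v N \<longleftrightarrow> c = 0 \<or> 0 \<le> v c" for c
    using Fract_in_nest_ring[of 1 "[:c:]"] omega_nest_const[of c] omega_nest_const[of 1]
    by (cases "c = 0") (auto simp: const_fr_def one_pCons)
  then show ?thesis
    using valuation_preorder.ring_of_valuation_ring[OF nest_valuation_preorder]
    unfolding VV_def nest_ring_eq by simp
qed

lemma lin_cut_nest_ring:
  assumes "B \<in> N" "b \<notin> B" "z \<in> B"
  shows "lin_cut (nest_ring v N) b = qc_of (v (z - b))"
proof -
  note V = nest_ring_in_VV
  have l: "omega_nest v N [:- b, 1:] = v (z - b)"
    using omega_nest_eq[of "[:- b, 1:]" B z] assms by auto
  have "v c \<in> fst (lin_cut (nest_ring v N) b) \<longleftrightarrow> v c \<le> v (z - b)" if "c \<noteq> 0" for c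
    using that by (simp add: lin_cut_lower[OF V] const_fr_def vle_Fract Fract_in_nest_ring l omega_nest_const)
  moreover have "v c \<in> snd (lin_cut (nest_ring v N) b) \<longleftrightarrow> v (z - b) \<le> v c" if "c \<noteq> 0" for c
    using that by (simp add: lin_cut_upper[OF V] const_fr_def vle_Fract Fract_in_nest_ring l omega_nest_const)
  ultimately show ?thesis using onto by (auto simp: prod_eq_iff set_eq_iff qc_of_def) metis+
qed

lemma nest_ball_subset_cball:
  assumes "B \<in> N" "b \<notin> B" "z \<in> B"
  shows "B \<subseteq> cball_v v b (v (z - b))"
proof
  fix c assume "c \<in> B"
  obtain a \<gamma> where a: "B = cball_v v a \<gamma>" using nest_cball assms(1) by blast
  then have "v (c - b) = v (z - b)"
    using v_diff_outside_cball(2) assms \<open>c \<in> B\<close> by metis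
  then show "c \<in> cball_v v b (v (z - b))" by (simp add: cball_v_def)
qed

end

text \<open>At each \<open>b\<close>, a ball of \<open>N'\<close> is taken inside a ball of
  \<open>N\<close> that avoids \<open>b\<close>; one point \<open>z\<close> then computes both
  linear cuts.\<close>

lemma nest_ring_cofinal:
  assumes N: "is_nest v N" and N': "is_nest v N'" and "mutually_cofinal N N'"
  shows "nest_ring v N = nest_ring v N'"
proof (rule VV_eqI[OF nest_ring_in_VV[OF N] nest_ring_in_VV[OF N']])
  fix b
  obtain B where B: "B \<in> N" "b \<notin> B" using nest_avoid[OF N] by blast
  then obtain B' where B': "B' \<in> N'" "B' \<subseteq> B" using assms(3) unfolding mutually_cofinal_def by blast
  obtain z where z: "z \<in> B'" using nest_nonempty[OF N' B'(1)] by blast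
  have "z \<in> B" "b \<notin> B'" using z B B' by auto
  then show "lin_cut (nest_ring v N) b = lin_cut (nest_ring v N') b"
    using lin_cut_nest_ring[OF N B] lin_cut_nest_ring[OF N' B'(1) _ z] by simp
qed

section \<open>The isomorphism of posets\<close>

text \<open>The centre selected by \<open>SOME\<close> lies in the ball, and the valuation does not
  depend on the centre.\<close>

lemma omega_map_BPt:
  assumes q: "is_qcut \<delta>"
  shows "omega_map v (BPt (ball_v v a \<delta>) \<delta>) = omega_ring v a \<delta>"
proof -
  let ?a = "SOME a'. ball_v v a \<delta> = ball_v v a' \<delta>"
  have "ball_v v a \<delta> = ball_v v ?a \<delta>" by (rule someI[of _ a]) simp
  then have "?a \<in> ball_v v a \<delta>" using mem_ball_v[OF q, of ?a ?a] by simp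
  then show ?thesis using omega_ring_recenter[OF q] by simp
qed

lemma mutually_cofinal_refl: "mutually_cofinal N N"
  by (auto simp: mutually_cofinal_def)

lemma mutually_cofinal_sym: "mutually_cofinal N N' \<Longrightarrow> mutually_cofinal N' N"
  by (auto simp: mutually_cofinal_def)

lemma mutually_cofinal_trans:
  assumes "mutually_cofinal N N'" "mutually_cofinal N' N''"
  shows "mutually_cofinal N N''"
  using assms unfolding mutually_cofinal_def by (meson order_trans)

abbreviation nest_class :: "'a set set \<Rightarrow> 'a set set set" where
  "nest_class N \<equiv> {N'. is_nest v N' \<and> mutually_cofinal N N'}"

lemma omega_map_BInf:
  assumes N: "is_nest v N"
  shows "omega_map v (BInf (nest_class N)) = nest_ring v N"
proof -
  let ?N = "SOME N'. N' \<in> nest_class N"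
  have "?N \<in> nest_class N" by (rule someI[of _ N]) (simp add: N mutually_cofinal_refl)
  then have "nest_ring v N = nest_ring v ?N" using nest_ring_cofinal[OF N] by blast
  then show ?thesis by simp
qed

lemma nest_class_eq: "mutually_cofinal N N' \<Longrightarrow> nest_class N = nest_class N'"
  using mutually_cofinal_trans mutually_cofinal_sym by blast

lemma BB_le_nest_class_iff:
  assumes N: "is_nest v N"
  shows "BB_le (BPt B \<delta>) (BInf (nest_class N)) \<longleftrightarrow> (\<exists>Bi\<in>N. Bi \<subseteq> B)"
proof
  assume "BB_le (BPt B \<delta>) (BInf (nest_class N))"
  then obtain N' Bi where "mutually_cofinal N N'" "Bi \<in> N'" "Bi \<subseteq> B" by auto
  then show "\<exists>Bi\<in>N. Bi \<subseteq> B" unfolding mutually_cofinal_def by (meson order_trans)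
qed (use N mutually_cofinal_refl in auto)

lemma BB_cases [consumes 1, case_names nest ball]:
  assumes "P \<in> BB v"
  obtains N where "is_nest v N" "P = BInf (nest_class N)"
  | a \<delta> where "is_qcut \<delta>" "P = BPt (ball_v v a \<delta>) \<delta>"
  using assms unfolding BB_def by blast

lemma omega_map_in_VV: "P \<in> BB v \<Longrightarrow> omega_map v P \<in> VV v"
  by (cases P rule: BB_cases)
    (simp_all only: omega_map_BPt omega_map_BInf omega_ring_in_VV nest_ring_in_VV)

lemma BB_le_imp_VV_le:
  assumes "P \<in> BB v" "Q \<in> BB v" "BB_le P Q"
  shows "VV_le (omega_map v P) (omega_map v Q)"
proof (cases "P = Q")
  case True
  then show ?thesis by (simp add: VV_le_def)
next
  case neq: False
  from assms(1) show ?thesis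
  proof (cases rule: BB_cases)
    case (nest N)
    then show ?thesis using assms neq by (cases Q) auto
  next
    case P: (ball a \<delta>)
    note q = P(1)
    from assms(2) show ?thesis
    proof (cases rule: BB_cases)
      case Q: (nest N)
      obtain Bi where Bi: "Bi \<in> N" "Bi \<subseteq> ball_v v a \<delta>"
        using assms(3) BB_le_nest_class_iff[OF Q(1)] P Q by auto
      show ?thesis
        unfolding P(2) Q(2) omega_map_BPt[OF q] omega_map_BInf[OF Q(1)]
      proof (rule VV_leI[OF omega_ring_in_VV[OF q] nest_ring_in_VV[OF Q(1)]])
        fix b
        \<comment> \<open>A point \<open>z\<close> of a ball inside \<open>Bi\<close> that avoids
          \<open>b\<close> can serve as centre for the first valuation and computes the second at
          \<open>x - b\<close>; \<open>v (z - b)\<close> is the intermediate value.\<close>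
        obtain B where B: "B \<in> N" "B \<subseteq> Bi" "b \<notin> B" using nest_avoid_finite[OF Q(1), of "{b}" Bi] Bi by auto
        obtain z where z: "z \<in> B" using nest_nonempty[OF Q(1) B(1)] by blast
        then have "omega_ring v a \<delta> = omega_ring v z \<delta>"
          using omega_ring_recenter[OF q, of z a] Bi B by auto
        moreover have "b \<noteq> z" using z B by auto
        ultimately have "v (z - b) \<in> snd (lin_cut (omega_ring v a \<delta>) b)"
          by (simp add: lin_cut_omega_ring[OF q])
        then show "\<exists>\<gamma>. \<gamma> \<in> snd (lin_cut (omega_ring v a \<delta>) b) \<and> \<gamma> \<in> fst (lin_cut (nest_ring v N) b)"
          using lin_cut_nest_ring[OF Q(1) B(1,3) z] by (auto simp: qc_of_def)
      qed
    next
      case Q: (ball a' \<epsilon>)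
      have sub: "ball_v v a' \<epsilon> \<subseteq> ball_v v a \<delta>" and le: "qc_le \<delta> \<epsilon>" using assms(3) P Q by auto
      have a': "a' \<in> ball_v v a \<delta>" using sub mem_ball_v[OF Q(1)] by blast
      note rc = omega_ring_recenter[OF q a']
      \<comment> \<open>With equal quasi-cuts the inclusion of balls is an equality, because
        \<open>a'\<close> is also a centre of the larger ball; then \<open>P\<close> and
        \<open>Q\<close> would coincide.\<close>
      have "\<delta> \<noteq> \<epsilon>"
      proof
        assume de: "\<delta> = \<epsilon>"
        have "c \<in> ball_v v a' \<delta>" if "c \<in> ball_v v a \<delta>" for c
        proof -
          have *: "v (a - a') \<in> snd \<delta> \<or> a = a'" "v (c - a) \<in> snd \<delta> \<or> c = a"
            using a' that mem_ball_v[OF q] v_minus_commute[of a a'] by auto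
          have "c = a' \<or> min (v (c - a)) (v (a - a')) \<le> v (c - a')" if "c \<noteq> a" "a \<noteq> a'"
            using v_add[of "c - a" "a - a'"] that by auto
          then show ?thesis using * qcut_up[OF q] mem_ball_v[OF q] by (metis min_def)
        qed
        then have "ball_v v a' \<epsilon> = ball_v v a \<delta>" using sub de by blast
        then show False using neq P Q de by simp
      qed
      \<comment> \<open>Strict inequality of quasi-cuts leaves an element of \<Gamma> weakly between
        them.\<close>
      then obtain t where t: "t \<in> snd \<delta>" "t \<in> fst \<epsilon>"
        using le q Q(1) unfolding qc_le_def is_qcut_def prod_eq_iff by blast
      show ?thesis
        unfolding P(2) Q(2) omega_map_BPt[OF q] omega_map_BPt[OF Q(1)] rc[symmetric]
      proof (rule VV_leI[OF omega_ring_in_VV[OF q] omega_ring_in_VV[OF Q(1)]])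
        fix b
        \<comment> \<open>With the common centre \<open>a'\<close>, both linear values are minima
          with \<open>v (a' - b)\<close>, so \<open>t\<close> is truncated in the same way.\<close>
        let ?g = "if b = a' then t else min t (v (a' - b))"
        have "?g \<in> fst \<epsilon>" using qcut_down[OF Q(1) t(2)] by auto
        then show "\<exists>\<gamma>. \<gamma> \<in> snd (lin_cut (omega_ring v a' \<delta>) b) \<and> \<gamma> \<in> fst (lin_cut (omega_ring v a' \<epsilon>) b)"
          using t by (intro exI[of _ ?g]) (auto simp: lin_cut_omega_ring[OF q] lin_cut_omega_ring[OF Q(1)] min_def)
      qed
    qed
  qed
qed

lemma lin_cut_le_imp_BB_le:
  assumes "P \<in> BB v" "Q \<in> BB v" and le: "\<And>b. qc_le (lin_cut (omega_map v P) b) (lin_cut (omega_map v Q) b)"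
  shows "BB_le P Q"
  using assms(1)
proof (cases rule: BB_cases)
  case P: (nest N)
  note RP = omega_map_BInf[OF P(1), folded P(2)]
  \<comment> \<open>A deeper ball avoiding \<open>b\<close> lies in the given one, so its points
    differ from \<open>b\<close> by value at least the radius.\<close>
  have inside: "\<exists>z. v (z - b) \<ge> \<gamma> \<and> lin_cut (nest_ring v N) b = qc_of (v (z - b))"
    if mem: "cball_v v a \<gamma> \<in> N" "b \<in> cball_v v a \<gamma>" for a \<gamma> b
  proof -
    obtain B where B: "B \<in> N" "B \<subseteq> cball_v v a \<gamma>" "b \<notin> B"
      using nest_avoid_finite[OF P(1) _ mem(1), of "{b}"] by auto
    obtain z where z: "z \<in> B" using nest_nonempty[OF P(1) B(1)] by blast
    have "(z - a) - (b - a) = 0 \<or> \<gamma> \<le> v ((z - a) - (b - a))"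
      by (rule v_diff_ge) (use z B mem in \<open>auto simp: cball_v_def\<close>)
    then show ?thesis using lin_cut_nest_ring[OF P(1) B(1,3) z] z B by auto
  qed
  from assms(2) show ?thesis
  proof (cases rule: BB_cases)
    case Q: (nest N')
    note RQ = omega_map_BInf[OF Q(1), folded Q(2)]
    have fine: "\<exists>B'\<in>N'. B' \<subseteq> B" if B: "B \<in> N" for B
    proof -
      obtain a \<gamma> where a: "B = cball_v v a \<gamma>" using nest_cball[OF P(1) B] by blast
      obtain z where z: "\<gamma> \<le> v (z - a)" "lin_cut (nest_ring v N) a = qc_of (v (z - a))"
        using inside[of a \<gamma> a] B a center_in_cball by blast
      obtain B' where B': "B' \<in> N'" "a \<notin> B'" using nest_avoid[OF Q(1)] by blast
      obtain y where y: "y \<in> B'" using nest_nonempty[OF Q(1) B'(1)] by blast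
      \<comment> \<open>The hypothesis at \<open>a\<close> bounds \<open>v (y - a)\<close> below by
        the radius of \<open>B\<close>; as the points of \<open>B'\<close> are equidistant from
        \<open>a\<close>, they all lie in \<open>B\<close>.\<close>
      have "v (z - a) \<le> v (y - a)"
        using le[of a] lin_cut_nest_ring[OF Q(1) B' y] z(2) unfolding RP RQ by (auto simp: qc_le_def qc_of_def)
      then have "cball_v v a (v (y - a)) \<subseteq> B" using z(1) unfolding a cball_v_def by auto
      then show ?thesis using nest_ball_subset_cball[OF Q(1) B' y] B'(1) by blast
    qed
    have "\<exists>B\<in>N. B \<subseteq> B'" if B': "B' \<in> N'" for B'
    proof (rule ccontr)
      assume no: "\<not> (\<exists>B\<in>N. B \<subseteq> B')"
      \<comment> \<open>The ball \<open>C\<close> provides a common point of \<open>B\<close> and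
        \<open>B'\<close>, and closed balls sharing a point are comparable. Hence \<open>B'\<close>
        lies in every ball of \<open>N\<close>, against the empty intersection.\<close>
      have "B' \<subseteq> B" if B: "B \<in> N" for B
      proof -
        obtain C where C: "C \<in> N'" "C \<subseteq> B" using fine[OF B] by blast
        obtain x where x: "x \<in> B" "x \<in> B'"
        proof (cases "C \<subseteq> B'")
          case True
          then show ?thesis using nest_nonempty[OF Q(1) C(1)] C that by blast
        next
          case False
          then have "B' \<subseteq> C" using nest_chain[OF Q(1) B' C(1)] by blast
          then show ?thesis using nest_nonempty[OF Q(1) B'] C that by blast
        qed
        obtain a \<gamma> where a: "B = cball_v v a \<gamma>" using nest_cball[OF P(1) B] by blast
        obtain a' \<gamma>' where a': "B' = cball_v v a' \<gamma>'" using nest_cball[OF Q(1) B'] by blast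
        have *: "cball_v v a \<gamma> = {c. c - x = 0 \<or> \<gamma> \<le> v (c - x)}" if "x \<in> cball_v v a \<gamma>" for a \<gamma>
        proof -
          have xa: "x - a = 0 \<or> \<gamma> \<le> v (x - a)" using that by (auto simp: cball_v_def)
          have "c - x = 0 \<or> \<gamma> \<le> v (c - x)" if "c - a = 0 \<or> \<gamma> \<le> v (c - a)" for c
            using v_diff_ge[OF that xa] by simp
          moreover have "c - a = 0 \<or> \<gamma> \<le> v (c - a)" if "c - x = 0 \<or> \<gamma> \<le> v (c - x)" for c
            using v_add_ge[OF that xa] by simp
          ultimately show ?thesis by (auto simp: cball_v_def)
        qed
        have "B = {c. c - x = 0 \<or> \<gamma> \<le> v (c - x)}" "B' = {c. c - x = 0 \<or> \<gamma>' \<le> v (c - x)}"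
          using * x a a' by auto
        moreover have "\<not> B \<subseteq> B'" using no B by blast
        ultimately show ?thesis by auto
      qed
      then have "B' \<subseteq> \<Inter>N" by blast
      then show False using P(1) nest_nonempty[OF Q(1) B'] by (auto simp: is_nest_def)
    qed
    then have "mutually_cofinal N N'" using fine by (simp add: mutually_cofinal_def)
    then show ?thesis using P Q nest_class_eq by simp
  next
    case Q: (ball a \<delta>)
    note RQ = omega_map_BPt[OF Q(1), of a, folded Q(2)]
    obtain B where B: "B \<in> N" "a \<notin> B" using nest_avoid[OF P(1)] by blast
    obtain b \<gamma> where b: "B = cball_v v b \<gamma>" using nest_cball[OF P(1) B(1)] by blast
    obtain z where z: "\<gamma> \<le> v (z - b)" "lin_cut (nest_ring v N) b = qc_of (v (z - b))"
      using inside[of b \<gamma> b] B b center_in_cball by blast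
    \<comment> \<open>No nest lies below a ball: the second valuation gives \<open>x - b\<close> at
      most \<open>v (a - b)\<close>, the nest at least the radius of \<open>B\<close>, and this
      forces the excluded \<open>a\<close> into \<open>B\<close>.\<close>
    have "v (z - b) \<le> v (a - b)"
      using le[of b] z(2) B b center_in_cball[of b \<gamma>] unfolding RP RQ
      by (auto simp: qc_le_def qc_of_def lin_cut_omega_ring[OF Q(1)])
    then have "a \<in> B" using z(1) b by (auto simp: cball_v_def)
    then show ?thesis using B by blast
  qed
next
  case P: (ball a \<delta>)
  note q = P(1)
  note RP = omega_map_BPt[OF q, of a, folded P(2)]
  from assms(2) show ?thesis
  proof (cases rule: BB_cases)
    case Q: (nest N)
    note RQ = omega_map_BInf[OF Q(1), folded Q(2)]
    obtain B where B: "B \<in> N" "a \<notin> B" using nest_avoid[OF Q(1)] by blast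
    obtain z where z: "z \<in> B" using nest_nonempty[OF Q(1) B(1)] by blast
    have "v (z - a) \<in> snd \<delta>"
      using le[of a] lin_cut_nest_ring[OF Q(1) B z] unfolding RP RQ
      by (auto simp: qc_le_def qc_of_def lin_cut_omega_ring[OF q])
    then have "cball_v v a (v (z - a)) \<subseteq> ball_v v a \<delta>"
      using qcut_up[OF q] mem_ball_v[OF q] by (auto simp: cball_v_def)
    then have "B \<subseteq> ball_v v a \<delta>" using nest_ball_subset_cball[OF Q(1) B z] by blast
    then show ?thesis using BB_le_nest_class_iff[OF Q(1)] B P Q by blast
  next
    case Q: (ball a' \<epsilon>)
    note RQ = omega_map_BPt[OF Q(1), of a', folded Q(2)]
    \<comment> \<open>At \<open>b = a\<close> the first linear cut is \<open>\<delta>\<close> itself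
      and the second is the minimum of \<open>\<epsilon>\<close> and \<open>v (a' - a)\<close>, so
      one comparison yields both the order of the radii and the position of
      \<open>a'\<close>.\<close>
    have *: "fst \<delta> \<subseteq> fst \<epsilon>" "snd \<epsilon> \<subseteq> snd \<delta>" "a' = a \<or> v (a' - a) \<in> snd \<delta>"
      using le[of a] unfolding RP RQ
      by (auto simp: qc_le_def lin_cut_omega_ring[OF q] lin_cut_omega_ring[OF Q(1)])
    have "c \<in> ball_v v a \<delta>" if "c \<in> ball_v v a' \<epsilon>" for c
    proof (cases "c = a' \<or> a' = a")
      case True
      then show ?thesis using that * mem_ball_v[OF q] mem_ball_v[OF Q(1)] by auto
    next
      case False
      have "c = a \<or> min (v (c - a')) (v (a' - a)) \<le> v (c - a)"
        using v_add[of "c - a'" "a' - a"] False by auto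
      moreover have "min (v (c - a')) (v (a' - a)) \<in> snd \<delta>"
        using that * False mem_ball_v[OF Q(1)] by (auto simp: min_def)
      ultimately show ?thesis using qcut_up[OF q] mem_ball_v[OF q] by blast
    qed
    then show ?thesis using P Q * by (auto simp: qc_le_def)
  qed
qed

lemma BB_le_antisym: "BB_le P Q \<Longrightarrow> BB_le Q P \<Longrightarrow> P = Q"
  by (cases P; cases Q) (auto simp: qc_le_def prod_eq_iff)

lemma omega_map_surj:
  assumes R: "R \<in> VV v"
  shows "\<exists>P\<in>BB v. omega_map v P = R"
proof -
  note VR = VV_valuation_ring[OF R]
  note lower = lin_cut_lower[OF R] and upper = lin_cut_upper[OF R]
  note q = lin_cut_qcut[OF R]
  \<comment> \<open>The difference of \<open>x - b\<close> and \<open>x - a\<close> is the constant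
    \<open>a - b\<close>, so a common lower bound of the two values bounds
    \<open>v (a - b)\<close>.\<close>
  have diff: "a = b \<or> \<gamma> \<le> v (a - b)" if ab: "\<gamma> \<in> fst (lin_cut R a)" "\<gamma> \<in> fst (lin_cut R b)" for a b \<gamma>
  proof -
    obtain c where c: "c \<noteq> 0" "v c = \<gamma>" using onto by blast
    have "vle R (const_fr c) (lin b - lin a)"
      using vle_diff[OF VR, of "const_fr c" "lin b" "lin a"] ab lower[of c] c by blast
    then show ?thesis using vle_const[OF R, of c "a - b"] c unfolding lin_diff by auto
  qed
  have diff_strict: "a = b \<or> \<gamma> < v (a - b)" if ab: "\<gamma> \<notin> snd (lin_cut R a)" "\<gamma> \<notin> snd (lin_cut R b)" for a b \<gamma>
  proof -
    obtain c where c: "c \<noteq> 0" "v c = \<gamma>" using onto by blast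
    have "\<not> vle R (lin b) (const_fr c)" using ab upper[OF c(1)] c(2) by auto
    moreover have "\<not> vle R (- lin a) (const_fr c)"
      using ab upper[OF c(1)] c(2) vle_trans[OF VR vle_minus[OF VR vle_refl[OF VR]]] by metis
    ultimately have "\<not> vle R (lin b + - lin a) (const_fr c)" by (rule vle_add_strict[OF VR])
    moreover have "lin b + - lin a = const_fr (a - b)"
      using lin_diff[of b a] by (simp only: diff_conv_add_uminus)
    ultimately show ?thesis using vle_const[OF R, of "a - b" c] c by auto
  qed
  show ?thesis
  proof (cases "\<exists>a. \<forall>b. qc_le (lin_cut R b) (lin_cut R a)")
    case True
    then obtain a where a: "\<And>b. fst (lin_cut R b) \<subseteq> fst (lin_cut R a)" "\<And>b. snd (lin_cut R a) \<subseteq> snd (lin_cut R b)"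
      by (auto simp: qc_le_def)
    let ?\<delta> = "lin_cut R a"
    have "omega_ring v a ?\<delta> = R"
    proof (rule VV_eqI[OF omega_ring_in_VV[OF q] R])
      fix b
      have "\<gamma> \<in> fst (lin_cut R b)" if "\<gamma> \<in> fst ?\<delta>" "b \<noteq> a" "\<gamma> \<le> v (a - b)" for \<gamma>
      proof -
        obtain c where c: "c \<noteq> 0" "v c = \<gamma>" using onto by blast
        have "vle R (const_fr c) (lin a + const_fr (a - b))"
          by (rule vle_add[OF VR]) (use that c lower vle_const[OF R] in auto)
        then show ?thesis using lower[OF c(1), of b] c unfolding lin_eq_add[of b a] by simp
      qed
      moreover have "b = a \<or> \<gamma> \<le> v (a - b)" if "\<gamma> \<in> fst (lin_cut R b)" for \<gamma>
        using diff[of \<gamma> a b] a that by auto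
      \<comment> \<open>By contraposition: a \<open>\<gamma>\<close> outside the right side at
        \<open>b\<close> is, by maximality, outside it at \<open>a\<close>, and
        \<open>diff_strict\<close> gives \<open>\<gamma> < v (a - b)\<close>.\<close>
      moreover have "\<gamma> \<in> snd (lin_cut R b)" if "b \<noteq> a" "v (a - b) \<le> \<gamma>" for \<gamma>
        using diff_strict[of \<gamma> a b] a(2)[of b] that by (auto simp: not_less[symmetric])
      moreover have "\<gamma> \<in> snd ?\<delta> \<or> b \<noteq> a \<and> v (a - b) \<le> \<gamma>" if g: "\<gamma> \<in> snd (lin_cut R b)" for \<gamma>
      proof (rule ccontr)
        assume "\<not> ?thesis"
        then have 1: "\<gamma> \<notin> snd ?\<delta>" and 2: "b = a \<or> \<gamma> < v (a - b)" by auto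
        obtain c where c: "c \<noteq> 0" "v c = \<gamma>" using onto by blast
        have "\<not> vle R (lin a) (const_fr c)" using 1 upper c by auto
        moreover have "\<not> vle R (const_fr (a - b)) (const_fr c)" if "b \<noteq> a"
          using vle_const[OF R] 2 c that by auto
        ultimately have "\<not> vle R (lin b) (const_fr c)"
          using vle_add_strict[OF VR] unfolding lin_eq_add[of b a] by (cases "b = a") auto
        then show False using g upper c by auto
      qed
      ultimately show "lin_cut (omega_ring v a ?\<delta>) b = lin_cut R b"
        unfolding lin_cut_omega_ring[OF q] prod_eq_iff
        using a(1)[of b] a(2)[of b] by auto
    qed
    moreover have "BPt (ball_v v a ?\<delta>) ?\<delta> \<in> BB v" using q unfolding BB_def by blast
    ultimately show ?thesis using omega_map_BPt[OF q] by blast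
  next
    case False
    have ex: "\<exists>b r. b \<noteq> a \<and> v (a - b) = r \<and> lin_cut R a = qc_of r \<and> \<not> qc_le (lin_cut R b) (lin_cut R a)" for a
    proof -
      obtain b where b: "\<not> qc_le (lin_cut R b) (lin_cut R a)" using False by blast
      \<comment> \<open>By totality \<open>x - b\<close> has strictly larger value than
        \<open>x - a\<close>, so their difference is a constant with the value of
        \<open>x - a\<close>. This places \<open>D(a)\<close> in \<Gamma>.\<close>
      have nle: "\<not> vle R (lin b) (lin a)"
      proof
        assume le: "vle R (lin b) (lin a)"
        have "x \<in> fst (lin_cut R a)" if "x \<in> fst (lin_cut R b)" for x
          using that vle_trans[OF VR _ le] unfolding lin_cut_def by auto
        moreover have "x \<in> snd (lin_cut R b)" if "x \<in> snd (lin_cut R a)" for x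
          using that vle_trans[OF VR le] unfolding lin_cut_def by auto
        ultimately show False using b by (auto simp: qc_le_def)
      qed
      have ba: "b \<noteq> a" using nle vle_refl[OF VR] by auto
      have "\<not> vle R (- lin b) (lin a)"
        using nle vle_trans[OF VR vle_minus[OF VR vle_refl[OF VR]]] by blast
      moreover have "lin a + - lin b = const_fr (b - a)"
        using lin_diff[of a b] by (simp only: diff_conv_add_uminus)
      ultimately have "vle R (lin a) (const_fr (b - a))" "vle R (const_fr (b - a)) (lin a)"
        using vle_add_dominated[OF VR, of "- lin b" "lin a"] by simp_all
      then have mem: "v (a - b) \<in> fst (lin_cut R a)" "v (a - b) \<in> snd (lin_cut R a)"
        using lower[of "b - a" a] upper[of "b - a" a] ba v_minus_commute[of a b] by auto
      have "\<not> is_cut (lin_cut R a)" using mem by (auto simp: is_cut_def)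
      then obtain r where r: "lin_cut R a = qc_of r" using qcut_not_cutE[OF q] by blast
      then have "v (a - b) = r" using mem by (auto simp: qc_of_def)
      then show ?thesis using r ba b by blast
    qed
    then have "\<forall>a. \<exists>r. lin_cut R a = qc_of r" by blast
    then obtain r where r: "\<And>a. lin_cut R a = qc_of (r a)" by metis
    have step: "\<exists>b. b \<noteq> a \<and> v (a - b) = r a \<and> r a < r b" for a
    proof -
      obtain b s where b: "b \<noteq> a" "v (a - b) = s" "lin_cut R a = qc_of s" "\<not> qc_le (lin_cut R b) (lin_cut R a)"
        using ex[of a] by blast
      have "s = r a" using b(3) r[of a] by (simp add: qc_of_def)
      moreover have "r a < r b" using b(4) unfolding r by (rule contrapos_np) (auto simp: qc_le_def qc_of_def)
      ultimately show ?thesis using b by blast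
    qed
    \<comment> \<open>The radius at each centre is its own linear value; the larger it is, the
      smaller the ball.\<close>
    define N where "N = range (\<lambda>a. cball_v v a (r a))"
    have chain: "cball_v v b (r b) \<subseteq> cball_v v a (r a)" if "r a \<le> r b" for a b
    proof
      fix c assume "c \<in> cball_v v b (r b)"
      then have 1: "c - b = 0 \<or> r a \<le> v (c - b)" using that by (auto simp: cball_v_def)
      have 2: "b - a = 0 \<or> r a \<le> v (b - a)"
        using diff[of "r a" b a] that by (auto simp: r qc_of_def)
      show "c \<in> cball_v v a (r a)" using v_add_ge[OF 1 2] by (auto simp: cball_v_def)
    qed
    \<comment> \<open>The absence of a maximum gives a centre \<open>c\<close> with
      \<open>v (b - c) = r b < r c\<close>, so the ball around \<open>c\<close> omits
      \<open>b\<close>.\<close>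
    have outside: "\<exists>c. v (c - b) = r b \<and> b \<notin> cball_v v c (r c)" for b
    proof -
      obtain c where "c \<noteq> b" "v (b - c) = r b" "r b < r c" using step by blast
      then show ?thesis using v_minus_commute[of b c] by (intro exI[of _ c]) (auto simp: cball_v_def)
    qed
    have N: "is_nest v N"
      unfolding is_nest_def
    proof (intro conjI ballI)
      show "N \<noteq> {}" by (simp add: N_def)
      show "\<exists>a \<gamma>. B = cball_v v a \<gamma>" if "B \<in> N" for B using that by (auto simp: N_def)
      show "B \<subseteq> B' \<or> B' \<subseteq> B" if BB: "B \<in> N" "B' \<in> N" for B B'
      proof -
        obtain a b where "B = cball_v v a (r a)" "B' = cball_v v b (r b)" using BB by (auto simp: N_def)
        then show ?thesis using chain linear[of "r a" "r b"] by blast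
      qed
      show "\<Inter>N = {}" using outside by (fastforce simp: N_def)
    qed
    have "nest_ring v N = R"
    proof (rule VV_eqI[OF nest_ring_in_VV[OF N] R])
      fix b
      obtain c where c: "v (c - b) = r b" "b \<notin> cball_v v c (r c)" using outside by blast
      have "cball_v v c (r c) \<in> N" by (simp add: N_def)
      then show "lin_cut (nest_ring v N) b = lin_cut R b"
        using lin_cut_nest_ring[OF N _ c(2) center_in_cball] c(1) r by simp
    qed
    moreover have "BInf (nest_class N) \<in> BB v" using N unfolding BB_def by blast
    ultimately show ?thesis using omega_map_BInf[OF N] by blast
  qed
qed

end

theorem theorem2p10:
  fixes v :: "'a::field \<Rightarrow> 'g::linordered_ab_group_add"
  assumes "alg_closed TYPE('a)"
    and "is_valuation v"
    and "\<forall>\<gamma>. \<exists>x. x \<noteq> 0 \<and> v x = \<gamma>"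
  shows "bij_betw (omega_map v) (BB v) (VV v) \<and>
         (\<forall>P\<in>BB v. \<forall>Q\<in>BB v. BB_le P Q \<longleftrightarrow> VV_le (omega_map v P) (omega_map v Q))"
proof -
  interpret alg_closed_valued v using assms by unfold_locales
  have reflect: "BB_le P Q" if "P \<in> BB v" "Q \<in> BB v" "VV_le (omega_map v P) (omega_map v Q)" for P Q
    by (rule lin_cut_le_imp_BB_le[OF that(1,2)])
      (rule VV_le_imp_lin_cut_le[OF omega_map_in_VV[OF that(1)] omega_map_in_VV[OF that(2)] that(3)])
  \<comment> \<open>Equal images are comparable in both directions, so order reflection and
    antisymmetry give injectivity.\<close>
  have "inj_on (omega_map v) (BB v)"
  proof (rule inj_onI)
    fix P Q assume *: "P \<in> BB v" "Q \<in> BB v" "omega_map v P = omega_map v Q"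
    then show "P = Q"
      by (intro BB_le_antisym reflect) (simp_all add: VV_le_def)
  qed
  moreover have "omega_map v ` BB v = VV v"
    using omega_map_in_VV omega_map_surj by blast
  ultimately show ?thesis using reflect BB_le_imp_VV_le by (auto simp: bij_betw_def)
qed

end
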